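(* Let $n\ge 1$ and $d=2^n$. Let $X$ be the complete set of mutually unbiased bases in $\mathbb{C}^{2^n}$ given by the Galois ring construction, that is, the standard basis of $\mathbb{C}^{2^n}$ together with all the vectors $$\vec v_{ab}=\frac{1}{\sqrt{2^n}}\left(i^{\mathrm{tr}[(a+2b)x]}\right)_{x\in\mathcal{T}_n},\qquad a,b\in\mathcal{T}_n,$$ where $\mathcal{T}_n$ is the Teichmüller set of the Galois ring $GR(4,n)$ (for each $a\in\mathcal{T}_n$, the set $\{\vec v_{ab}:b\in\mathcal{T}_n\}$ is one of the bases). Let $N\subset X$ be the set of those vectors which are of the form $\frac{1}{\sqrt{d}}\,i^{\vec x}$ with $\vec x\in GR(4,1)^{2^n}$, i.e. $N=\{\vec v_{ab}:a,b\in\mathcal{T}_n\}$, and let $M=\{\vec x\in GR(4,1)^{2^n}:\frac{1}{\sqrt d}\,i^{\vec x}\in N\}$. Then: 1. $N$ (with the operation $\hat\odot$ and scalar action $\star$) is a $GR(4,1)$-module. 2. $M$ is a $2^{n-1}$ dimensional subspace of $PHG(2^n-1,GR(4,1))$.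
   Context: $GR(4,n)$ is the Galois ring of characteristic $4$ with $4^n$ elements (the degree $n$ unramified Galois extension of $GR(4,1)=\mathbb{Z}/4\mathbb{Z}$). Its Teichmüller set is $\mathcal{T}_n=\{0\}\cup\{1,\xi,\dots,\xi^{2^n-2}\}$, where $\xi$ is a unit of multiplicative order $2^n-1$; every element of $GR(4,n)$ is uniquely $a+2b$ with $a,b\in\mathcal{T}_n$. The generalized Frobenius automorphism is $\phi(a+2b)=a^2+2b^2$ for $a,b\in\mathcal{T}_n$, and the trace $\mathrm{tr}:GR(4,n)\to GR(4,1)$ is $\mathrm{tr}(y)=\sum_{j=0}^{n-1}\phi^j(y)$. Here $i=\sqrt{-1}$, coordinates are indexed by $x\in\mathcal{T}_n$ ($|\mathcal{T}_n|=2^n$), and for $\vec x=(x_j)\in GR(4,1)^{2^n}$, $i^{\vec x}$ denotes the complex vector $(i^{x_j})_j$. Let $\odot$ be componentwise multiplication of complex vectors and define $\vec v\,\hat\odot\,\vec u=\dfrac{\vec v\odot\vec u}{|\vec v\odot\vec u|}$, where $|\cdot|$ is the Euclidean norm. The scalar action of $r\in GR(4,1)$ is $r\star\frac{1}{\sqrt d}i^{\vec x}=\frac{1}{\sqrt d}i^{r\vec x}$, i.e. it corresponds to scalar multiplication on exponent vectors. $PHG(d-1,GR(4,1))$ is the projective Hjelmslev geometry constructed from $GR(4,1)$: it is the set of subspaces of $GR(4,1)^d$, where any free submodule of $GR(4,1)^d$ is a subspace. Its points are $\langle\vec x\rangle$, representing all vectors $\rho\vec x$ with $\rho$ a unit of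 $GR(4,1)$, where at least one entry of $\vec x$ is a unit. Dimension is projective dimension: an $m$ dimensional subspace has $2^m$ points in each of $2^{m+1}-1$ neighbourhoods, each point being represented by $2$ vectors. Two orthonormal bases of $\mathbb{C}^d$ are mutually unbiased if $|\langle\phi|\psi\rangle|^2=1/d$ for all $\phi$ in the first and $\psi$ in the second; a set of $d+1$ pairwise mutually unbiased bases of $\mathbb{C}^d$ is called complete.
   Formalization: In part 2 the dimension proved is n-1 instead of 2^{n-1}: M has 4^n elements, so it is free of rank n, whereas a 2^{n-1} dimensional subspace would have 4^{2^{n-1}+1} vectors, which is impossible for every n≥1 (for n=1, M={(0,r)} is a single point). *)

theory Defs
  imports
    Complex_Main
    "HOL-Library.FuncSet"
    "HOL-Analysis.L2_Norm"
    "HOL-Algebra.Multiplicative_Group"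
    "HOL-Number_Theory.Residues"
    "HOL-Algebra.Module"
begin

section \<open>Galois rings of characteristic 4\<close>

abbreviation Z4 :: "int ring" where
  "Z4 \<equiv> residue_ring 4"

text \<open>
  A Galois ring is a finite commutative ring whose zero divisors, together with 0, form the
  principal ideal generated by a prime p (times 1). Such a ring is determined up to isomorphism by
  its characteristic and its cardinality; \<open>galois_ring4 n R\<close> says that R is GR(4,n).
\<close>

definition zero_divisors :: "('a, 'b) ring_scheme \<Rightarrow> 'a set" where
  "zero_divisors R =
    {x \<in> carrier R - {\<zero>\<^bsub>R\<^esub>}. \<exists>y \<in> carrier R - {\<zero>\<^bsub>R\<^esub>}. x \<otimes>\<^bsub>R\<^esub> y = \<zero>\<^bsub>R\<^esub>}"

definition two :: "('a, 'b) ring_scheme \<Rightarrow> 'a" where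
  "two R = \<one>\<^bsub>R\<^esub> \<oplus>\<^bsub>R\<^esub> \<one>\<^bsub>R\<^esub>"

definition galois_ring4 :: "nat \<Rightarrow> ('a, 'b) ring_scheme \<Rightarrow> bool" where
  "galois_ring4 n R \<longleftrightarrow>
     cring R \<and> finite (carrier R) \<and> card (carrier R) = 4 ^ n \<and>
     group.ord (add_monoid R) \<one>\<^bsub>R\<^esub> = 4 \<and>
     zero_divisors R \<union> {\<zero>\<^bsub>R\<^esub>} = PIdl\<^bsub>R\<^esub> (two R)"

definition teichmueller :: "('a, 'b) ring_scheme \<Rightarrow> nat \<Rightarrow> 'a \<Rightarrow> 'a set" where
  "teichmueller R n \<xi> = {\<zero>\<^bsub>R\<^esub>} \<union> {\<xi> [^]\<^bsub>R\<^esub> k | k::nat. k < 2 ^ n - 1}"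

definition from_digits :: "('a, 'b) ring_scheme \<Rightarrow> 'a \<Rightarrow> 'a \<Rightarrow> 'a" where
  "from_digits R a b = a \<oplus>\<^bsub>R\<^esub> two R \<otimes>\<^bsub>R\<^esub> b"

definition frobenius :: "('a, 'b) ring_scheme \<Rightarrow> 'a set \<Rightarrow> 'a \<Rightarrow> 'a" where
  "frobenius R T y =
    (THE z. \<exists>a\<in>T. \<exists>b\<in>T. y = from_digits R a b \<and>
                       z = from_digits R (a [^]\<^bsub>R\<^esub> (2::nat)) (b [^]\<^bsub>R\<^esub> (2::nat)))"

definition trace :: "('a, 'b) ring_scheme \<Rightarrow> nat \<Rightarrow> 'a set \<Rightarrow> 'a \<Rightarrow> 'a" where
  "trace R n T y = (\<Oplus>\<^bsub>R\<^esub> j \<in> {..<n}. (frobenius R T ^^ j) y)"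

text \<open>
  The trace takes its values in the prime subring of R, which is identified with Z4 by
  sending k to k times 1.
\<close>

definition tr4 :: "('a, 'b) ring_scheme \<Rightarrow> nat \<Rightarrow> 'a set \<Rightarrow> 'a \<Rightarrow> int" where
  "tr4 R n T y = (THE k. k \<in> carrier Z4 \<and> [k] \<cdot>\<^bsub>R\<^esub> \<one>\<^bsub>R\<^esub> = trace R n T y)"

section \<open>Vectors with coordinates indexed by a finite set\<close>

text \<open>
  Vectors over an index set I with d elements are extensional functions on I: elements of
  \<open>I \<rightarrow>\<^sub>E UNIV\<close> for complex vectors and of \<open>I \<rightarrow>\<^sub>E carrier Z4\<close> for exponent vectors.
\<close>

definition phase_vec :: "'i set \<Rightarrow> ('i \<Rightarrow> int) \<Rightarrow> 'i \<Rightarrow> complex" where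
  "phase_vec I x = (\<lambda>j\<in>I. complex_of_real (1 / sqrt (real (card I))) * \<i> ^ nat (x j))"

definition cvec_norm :: "'i set \<Rightarrow> ('i \<Rightarrow> complex) \<Rightarrow> real" where
  "cvec_norm I v = L2_set (\<lambda>j. cmod (v j)) I"

definition cvec_mult :: "'i set \<Rightarrow> ('i \<Rightarrow> complex) \<Rightarrow> ('i \<Rightarrow> complex) \<Rightarrow> 'i \<Rightarrow> complex" where
  "cvec_mult I v u = (\<lambda>j\<in>I. v j * u j)"

definition hat_mult :: "'i set \<Rightarrow> ('i \<Rightarrow> complex) \<Rightarrow> ('i \<Rightarrow> complex) \<Rightarrow> 'i \<Rightarrow> complex" where
  "hat_mult I v u =
    (\<lambda>j\<in>I. cvec_mult I v u j / complex_of_real (cvec_norm I (cvec_mult I v u)))"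

definition phase_exponent :: "'i set \<Rightarrow> ('i \<Rightarrow> complex) \<Rightarrow> 'i \<Rightarrow> int" where
  "phase_exponent I v = (THE x. x \<in> I \<rightarrow>\<^sub>E carrier Z4 \<and> v = phase_vec I x)"

definition star :: "'i set \<Rightarrow> int \<Rightarrow> ('i \<Rightarrow> complex) \<Rightarrow> 'i \<Rightarrow> complex" where
  "star I r v = phase_vec I (\<lambda>j\<in>I. r \<otimes>\<^bsub>Z4\<^esub> phase_exponent I v j)"

text \<open>
  The group operation of the module is \<open>hat_mult\<close>, written additively in the record; its neutral
  element is the vector with exponent 0. The fields \<open>mult\<close> and \<open>one\<close> are part of the record type
  but play no role in the predicate \<open>module\<close>.
\<close>

definition phase_module :: "'i set \<Rightarrow> ('i \<Rightarrow> complex) set \<Rightarrow> (int, 'i \<Rightarrow> complex) module" where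
  "phase_module I N =
    \<lparr>carrier = N, monoid.mult = undefined, one = undefined,
     zero = phase_vec I (\<lambda>j\<in>I. 0), add = hat_mult I, smult = star I\<rparr>"

section \<open>The mutually unbiased bases\<close>

definition mub_vec :: "('a, 'b) ring_scheme \<Rightarrow> nat \<Rightarrow> 'a set \<Rightarrow> 'a \<Rightarrow> 'a \<Rightarrow> 'a \<Rightarrow> complex" where
  "mub_vec R n T a b = phase_vec T (\<lambda>x\<in>T. tr4 R n T (from_digits R a b \<otimes>\<^bsub>R\<^esub> x))"

definition standard_basis :: "'i set \<Rightarrow> ('i \<Rightarrow> complex) set" where
  "standard_basis I = {(\<lambda>j\<in>I. if j = k then 1 else 0) | k. k \<in> I}"

definition galois_mubs :: "('a, 'b) ring_scheme \<Rightarrow> nat \<Rightarrow> 'a set \<Rightarrow> ('a \<Rightarrow> complex) set set" where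
  "galois_mubs R n T = {standard_basis T} \<union> {{mub_vec R n T a b | b. b \<in> T} | a. a \<in> T}"

section \<open>Projective Hjelmslev geometry over Z4\<close>

definition Z4_power :: "'i set \<Rightarrow> (int, 'i \<Rightarrow> int) module" where
  "Z4_power I =
    \<lparr>carrier = I \<rightarrow>\<^sub>E carrier Z4, monoid.mult = undefined, one = undefined,
     zero = (\<lambda>j\<in>I. \<zero>\<^bsub>Z4\<^esub>), add = (\<lambda>x y. \<lambda>j\<in>I. x j \<oplus>\<^bsub>Z4\<^esub> y j),
     smult = (\<lambda>r x. \<lambda>j\<in>I. r \<otimes>\<^bsub>Z4\<^esub> x j)\<rparr>"

definition free_basis ::
  "('r, 's) ring_scheme \<Rightarrow> ('r, 'm, 't) module_scheme \<Rightarrow> 'm set \<Rightarrow> 'm set \<Rightarrow> bool" where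
  "free_basis K V S B \<longleftrightarrow> finite B \<and> B \<subseteq> S \<and>
     (\<forall>s\<in>S. \<exists>!c. c \<in> B \<rightarrow>\<^sub>E carrier K \<and> s = (\<Oplus>\<^bsub>V\<^esub> b\<in>B. c b \<odot>\<^bsub>V\<^esub> b))"

text \<open>
  \<open>phg_subspace I m S\<close>: S is an m-dimensional subspace of the projective Hjelmslev geometry
  PHG(d-1, GR(4,1)), where d is the cardinality of I. Subspaces are the free submodules; as the
  dimension is projective, m-dimensional means free of rank m+1. Such a submodule has
  \<open>4 ^ (m+1) - 2 ^ (m+1) = 2 * 2 ^ m * (2 ^ (m+1) - 1)\<close> vectors with a unit entry, i.e.
  \<open>2 ^ m\<close> points, each represented by 2 vectors, in each of \<open>2 ^ (m+1) - 1\<close> neighbourhoods.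
\<close>

definition phg_subspace :: "'i set \<Rightarrow> nat \<Rightarrow> ('i \<Rightarrow> int) set \<Rightarrow> bool" where
  "phg_subspace I m S \<longleftrightarrow>
     submodule S Z4 (Z4_power I) \<and> (\<exists>B. free_basis Z4 (Z4_power I) S B \<and> card B = m + 1)"

end

theory Submission
  imports Defs
begin

text \<open>
  The map sending \<open>c\<close> in the Galois ring to the vector \<open>(tr (c x))\<close>, \<open>x\<close> in the Teichmueller set,
  is additive, and it is injective because the trace form is nondegenerate. Hence its image, which
  is \<open>M\<close>, has \<open>4 ^ n\<close> elements and inherits from the ring the property that every element killed
  by 2 is a double; a finite Z4-module with this property is free, and counting gives rank \<open>n\<close>.
  Normalised componentwise multiplication of phase vectors is addition of exponents, so \<open>N\<close> is a
  copy of \<open>M\<close>.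
\<close>

section \<open>Submodules of powers of Z4\<close>

text \<open>The ring is given only by its cardinality, its characteristic and the fact that its zero
  divisors are the nonzero multiples of 2. Facts about the residue field are therefore phrased as
  congruences modulo 2 inside the ring, and 4 = 0 makes squares depend only on the class modulo 2.
  Nondegeneracy rests on two observations: every nonzero element has 2 among its multiples, and the
  trace is not even everywhere, because the sum of x^-1 tr x over the nonzero Teichmueller elements
  is the odd multiple 2^n - 1 of 1. The obstacle to freeness is a linear relation whose coefficient
  at the vector of interest is 2, which cannot be inverted modulo 4. The condition on elements
  killed by 2 is what resolves it.\<close>

lemma carrier_Z4: "carrier Z4 = {0..3}"
  and Z4_ops: "\<one>\<^bsub>Z4\<^esub> = 1" "\<zero>\<^bsub>Z4\<^esub> = 0"
    "x \<oplus>\<^bsub>Z4\<^esub> y = (x + y) mod 4" "x \<otimes>\<^bsub>Z4\<^esub> y = (x * y) mod 4"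
  by (simp_all add: residue_ring_def)

lemma cring_Z4: "cring Z4"
  by (rule residues.cring) (simp add: residues_def)

lemma Z4_power_simps [simp]:
  "carrier (Z4_power I) = I \<rightarrow>\<^sub>E {0..3}"
  "\<zero>\<^bsub>Z4_power I\<^esub> = (\<lambda>j\<in>I. 0)"
  "x \<oplus>\<^bsub>Z4_power I\<^esub> y = (\<lambda>j\<in>I. (x j + y j) mod 4)"
  "r \<odot>\<^bsub>Z4_power I\<^esub> x = (\<lambda>j\<in>I. (r * x j) mod 4)"
  by (simp_all add: Z4_power_def carrier_Z4 Z4_ops)

lemma mod_4_range: "(k :: int) mod 4 \<in> {0..3}"
  using pos_mod_bound[of 4 k] pos_mod_sign[of 4 k] by simp

lemma PiE_restrict_mod_4:
  assumes "x \<in> I \<rightarrow>\<^sub>E {0..3 :: int}"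
  shows "(\<lambda>j\<in>I. x j mod 4) = x"
  using assms by (intro ext) (auto simp: PiE_iff extensional_def restrict_def)

lemma module_Z4_power: "Module.module Z4 (Z4_power I)"
proof (rule moduleI)
  show "abelian_group (Z4_power I)"
  proof (rule abelian_groupI)
    fix x assume x: "x \<in> carrier (Z4_power I)"
    show "\<exists>y \<in> carrier (Z4_power I). y \<oplus>\<^bsub>Z4_power I\<^esub> x = \<zero>\<^bsub>Z4_power I\<^esub>"
    proof (intro bexI)
      show "(\<lambda>j\<in>I. - x j mod 4) \<oplus>\<^bsub>Z4_power I\<^esub> x = \<zero>\<^bsub>Z4_power I\<^esub>"
        by (auto simp: fun_eq_iff mod_simps)
    qed (use mod_4_range in auto)
    show "\<zero>\<^bsub>Z4_power I\<^esub> \<oplus>\<^bsub>Z4_power I\<^esub> x = x"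
      using x PiE_restrict_mod_4[of x I] by (auto cong: restrict_cong)
  qed (use mod_4_range in \<open>auto simp: fun_eq_iff mod_simps ac_simps\<close>)
next
  fix x assume x: "x \<in> carrier (Z4_power I)"
  show "\<one>\<^bsub>Z4\<^esub> \<odot>\<^bsub>Z4_power I\<^esub> x = x"
    using x PiE_restrict_mod_4[of x I] by (simp add: Z4_ops)
qed (use mod_4_range in \<open>auto simp: cring_Z4 Z4_ops fun_eq_iff mod_simps algebra_simps\<close>)

text \<open>Negation is scaling by -1, so closure under scalars supplies the additive inverses that
  \<open>submoduleI\<close> asks for.\<close>

lemma submodule_Z4_powerI:
  assumes "S \<subseteq> I \<rightarrow>\<^sub>E {0..3}" "(\<lambda>j\<in>I. 0) \<in> S"
    and "\<And>x y. x \<in> S \<Longrightarrow> y \<in> S \<Longrightarrow> (\<lambda>j\<in>I. (x j + y j) mod 4) \<in> S"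
    and "\<And>r x. r \<in> {0..3} \<Longrightarrow> x \<in> S \<Longrightarrow> (\<lambda>j\<in>I. (r * x j) mod 4) \<in> S"
  shows "submodule S Z4 (Z4_power I)"
proof -
  interpret V: Module.module Z4 "Z4_power I" by (rule module_Z4_power)
  show ?thesis
  proof (rule V.submoduleI)
    fix x assume x: "x \<in> S"
    have "\<ominus>\<^bsub>Z4_power I\<^esub> x = (\<ominus>\<^bsub>Z4\<^esub> \<one>\<^bsub>Z4\<^esub>) \<odot>\<^bsub>Z4_power I\<^esub> x"
      using V.smult_l_minus[of "\<one>\<^bsub>Z4\<^esub>" x] V.smult_one[of x] V.R.one_closed x assms(1) by auto
    moreover have "\<ominus>\<^bsub>Z4\<^esub> \<one>\<^bsub>Z4\<^esub> \<in> {0..3}"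
      using V.R.a_inv_closed[OF V.R.one_closed] by (simp only: carrier_Z4)
    ultimately show "\<ominus>\<^bsub>Z4_power I\<^esub> x \<in> S" using assms(4) x by simp
  qed (use assms in \<open>auto simp: carrier_Z4\<close>)
qed

lemma finsum_Z4_power:
  assumes "finite B" "f \<in> B \<rightarrow> (I \<rightarrow>\<^sub>E {0..3})"
  shows "finsum (Z4_power I) f B = (\<lambda>j\<in>I. (\<Sum>b\<in>B. f b j) mod 4)"
proof -
  interpret V: Module.module Z4 "Z4_power I" by (rule module_Z4_power)
  show ?thesis
    using assms
  proof (induction B)
    case (insert b B)
    then show ?case
      by (subst V.finsum_insert) (auto simp: fun_eq_iff mod_simps)
  qed simp
qed

section \<open>Linear combinations and bases over Z4\<close>

definition Z4_combination :: "'i set \<Rightarrow> ('i \<Rightarrow> int) set \<Rightarrow> (('i \<Rightarrow> int) \<Rightarrow> int) \<Rightarrow> 'i \<Rightarrow> int" where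
  "Z4_combination I B c = (\<lambda>j\<in>I. (\<Sum>b\<in>B. c b * b j) mod 4)"

text \<open>Coefficients are arbitrary integers and equality in Z4 is written as divisibility by 4,
  so that relations can be scaled, doubled and halved without renormalising.\<close>

definition Z4_independent :: "'i set \<Rightarrow> ('i \<Rightarrow> int) set \<Rightarrow> bool" where
  "Z4_independent I B \<longleftrightarrow>
     (\<forall>c. (\<forall>j\<in>I. 4 dvd (\<Sum>b\<in>B. c b * b j)) \<longrightarrow> (\<forall>b\<in>B. 4 dvd c b))"

lemma Z4_combination_closed:
  assumes S: "submodule S Z4 (Z4_power I)" and "finite B" "B \<subseteq> S"
  shows "Z4_combination I B c \<in> S"
proof -
  interpret V: Module.module Z4 "Z4_power I" by (rule module_Z4_power)
  interpret S: submodule S Z4 "Z4_power I" by (rule S)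
  show ?thesis
    using assms(2,3)
  proof (induction B)
    case empty
    then show ?case using S.one_closed by (simp add: Z4_combination_def del: restrict_apply)
  next
    case (insert b B)
    have "(\<lambda>j\<in>I. ((c b mod 4) * b j) mod 4) \<in> S"
      using S.smult_closed[of "c b mod 4" b] mod_4_range insert.prems by (simp add: carrier_Z4)
    then have "(\<lambda>j\<in>I. ((c b mod 4) * b j) mod 4) \<oplus>\<^bsub>Z4_power I\<^esub> Z4_combination I B c \<in> S"
      using S.m_closed[of "\<lambda>j\<in>I. ((c b mod 4) * b j) mod 4" "Z4_combination I B c"] insert
      by (simp del: restrict_apply)
    also have "(\<lambda>j\<in>I. ((c b mod 4) * b j) mod 4) \<oplus>\<^bsub>Z4_power I\<^esub> Z4_combination I B c =
        Z4_combination I (insert b B) c"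
      using insert by (auto simp: Z4_combination_def fun_eq_iff mod_simps)
    finally show ?case .
  qed
qed

text \<open>Take \<open>B\<close> to be a largest independent subset of \<open>S\<close>. Adding any
  v to it creates a relation, which expresses v through \<open>B\<close> up to twice an element of
  \<open>S\<close>. Repeating this for that element leaves four times a vector, which is 0.\<close>

lemma Z4_basis_exists:
  assumes S: "submodule S Z4 (Z4_power I)" and fin: "finite S"
    and even: "\<And>x. x \<in> S \<Longrightarrow> \<forall>j\<in>I. 2 dvd x j \<Longrightarrow> \<exists>w\<in>S. \<forall>j\<in>I. 4 dvd x j - 2 * w j"
  obtains B where "B \<subseteq> S" "Z4_independent I B" "\<And>v. v \<in> S \<Longrightarrow> \<exists>c. v = Z4_combination I B c"
proof -
  interpret S: submodule S Z4 "Z4_power I" by (rule S)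
  have SI: "x \<in> I \<rightarrow>\<^sub>E {0..3}" if "x \<in> S" for x using S.subset that by auto
  let ?P = "\<lambda>B. B \<subseteq> S \<and> Z4_independent I B"
  have "?P {}" by (simp add: Z4_independent_def)
  moreover have "\<forall>B. ?P B \<longrightarrow> card B < Suc (card S)" using fin by (simp add: card_mono less_Suc_eq_le)
  ultimately have "\<exists>B. ?P B \<and> (\<forall>C. ?P C \<longrightarrow> card C \<le> card B)" by (rule ex_has_greatest_nat)
  then obtain B where B: "?P B" and max: "\<And>C. ?P C \<Longrightarrow> card C \<le> card B" by metis
  have finB: "finite B" using B fin finite_subset by blast
  have indep: "\<forall>b\<in>B. 4 dvd c b" if "\<forall>j\<in>I. 4 dvd (\<Sum>b\<in>B. c b * b j)" for c
    using B that unfolding Z4_independent_def by blast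
  have half: "\<exists>c w. w \<in> S \<and> (\<forall>j\<in>I. 4 dvd v j - (\<Sum>b\<in>B. c b * b j) - 2 * w j)" if v: "v \<in> S" for v
  proof (cases "v \<in> B")
    case True
    have "(\<Sum>b\<in>B. (if b = v then 1 else 0) * b j) = v j" for j
      using True finB by (simp add: if_distrib[of "\<lambda>x. x * _"] sum.delta cong: if_cong)
    then show ?thesis
      using S.one_closed by (intro exI[of _ "\<lambda>b. if b = v then 1 else 0"] exI[of _ "\<lambda>j\<in>I. 0"]) auto
  next
    case False
    then have "\<not> Z4_independent I (insert v B)"
      using max[of "insert v B"] B v finB by auto
    then obtain c where c: "\<And>j. j \<in> I \<Longrightarrow> 4 dvd (\<Sum>b\<in>insert v B. c b * b j)"
      and nc: "\<exists>b\<in>insert v B. \<not> 4 dvd c b"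
      unfolding Z4_independent_def by blast
    have sum: "4 dvd c v * v j + (\<Sum>b\<in>B. c b * b j)" if "j \<in> I" for j
      using c[OF that] False finB by simp
    show ?thesis
    proof (cases "odd (c v)")
      case True
      \<comment> \<open>An odd coefficient is its own inverse modulo 4, so multiplying the relation
        by \<open>k\<close> solves it for v.\<close>
      define k where "k = c v"
      obtain h where "k = 2 * h + 1" using True k_def by (auto elim: oddE)
      then have k2: "4 dvd k * k - 1" by (simp add: algebra_simps)
      have "4 dvd v j - (\<Sum>b\<in>B. (- k * c b) * b j)" if "j \<in> I" for j
      proof -
        have "v j - (\<Sum>b\<in>B. (- k * c b) * b j) = k * (c v * v j + (\<Sum>b\<in>B. c b * b j)) - (k * k - 1) * v j"
          by (simp add: k_def sum_distrib_left sum_negf algebra_simps)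
        then show ?thesis using sum[OF that] k2 by simp
      qed
      then show ?thesis
        using S.one_closed by (intro exI[of _ "\<lambda>b. - k * c b"] exI[of _ "\<lambda>j\<in>I. 0"]) auto
    next
      case even_k: False
      \<comment> \<open>Doubling the relation removes v, whose coefficient becomes a multiple of 4.
        Independence then forces all coefficients on \<open>B\<close> to be even.\<close>
      have "4 dvd (\<Sum>b\<in>B. (2 * c b) * b j)" if "j \<in> I" for j
      proof -
        obtain h where h: "c v = 2 * h" using even_k by auto
        have "(\<Sum>b\<in>B. (2 * c b) * b j) = 2 * (\<Sum>b\<in>B. c b * b j)"
          by (simp add: sum_distrib_left ac_simps)
        also have "\<dots> = 2 * (c v * v j + (\<Sum>b\<in>B. c b * b j)) - 4 * (h * v j)"
          unfolding h by (simp add: algebra_simps)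
        finally have eq: "(\<Sum>b\<in>B. (2 * c b) * b j) =
            2 * (c v * v j + (\<Sum>b\<in>B. c b * b j)) - 4 * (h * v j)" .
        show ?thesis
          unfolding eq by (intro dvd_diff dvd_mult[OF sum[OF that]] dvd_triv_left)
      qed
      then have c2: "\<forall>b\<in>B. 4 dvd 2 * c b" using indep[of "\<lambda>b. 2 * c b"] by blast
      define d where "d b = c b div 2" for b
      have d: "c b = 2 * d b" if "b \<in> B" for b using bspec[OF c2 that] unfolding d_def by presburger
      \<comment> \<open>Otherwise the relation would live on \<open>B\<close> alone and be trivial.
        Hence the coefficient at v is 2 modulo 4.\<close>
      have "\<not> 4 dvd c v"
      proof
        assume "4 dvd c v"
        then have "4 dvd (\<Sum>b\<in>B. c b * b j)" if "j \<in> I" for j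
          using sum[OF that] by (simp add: dvd_add_right_iff)
        then show False using indep[of c] nc \<open>4 dvd c v\<close> by blast
      qed
      moreover obtain e where e: "c v = 2 * e" using even_k by auto
      ultimately have "odd e" by (auto elim!: evenE)
      then obtain h where "e = 2 * h + 1" by (rule oddE)
      then have h: "c v = 4 * h + 2" using e by simp
      \<comment> \<open>This is half of the relation, with coefficient 1 at v. It is killed by 2, so
        its entries are even and \<open>even\<close> writes it as 2 w with w in \<open>S\<close>;
        solving for v gives the claim.\<close>
      let ?y = "Z4_combination I (insert v B) (d(v := 1))"
      have y: "?y \<in> S" using Z4_combination_closed[OF S] B v finB by simp
      have ysum: "(\<Sum>b\<in>insert v B. (d(v := 1)) b * b j) = v j + (\<Sum>b\<in>B. d b * b j)" for j
        using False finB by (auto intro!: sum.cong)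
      have "2 dvd v j + (\<Sum>b\<in>B. d b * b j)" if "j \<in> I" for j
      proof -
        have "(\<Sum>b\<in>B. c b * b j) = 2 * (\<Sum>b\<in>B. d b * b j)"
          by (simp add: d sum_distrib_left algebra_simps)
        then have eq: "c v * v j + (\<Sum>b\<in>B. c b * b j) =
            4 * (h * v j) + 2 * (v j + (\<Sum>b\<in>B. d b * b j))" unfolding h by (simp add: algebra_simps)
        have "4 dvd 2 * (v j + (\<Sum>b\<in>B. d b * b j))"
          using sum[OF that] unfolding eq by (simp only: dvd_add_right_iff dvd_triv_left)
        moreover have "4 dvd 2 * x \<Longrightarrow> 2 dvd x" for x :: int by presburger
        ultimately show ?thesis by blast
      qed
      then have "\<forall>j\<in>I. 2 dvd ?y j"
        unfolding Z4_combination_def ysum by (auto simp: dvd_mod_iff)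
      then obtain w where w: "w \<in> S" "\<forall>j\<in>I. 4 dvd ?y j - 2 * w j" using even[OF y] by blast
      have "4 dvd v j - (\<Sum>b\<in>B. - d b * b j) - 2 * w j" if "j \<in> I" for j
      proof -
        have "4 dvd (v j + (\<Sum>b\<in>B. d b * b j)) mod 4 - 2 * w j"
          using w(2) that unfolding Z4_combination_def ysum by simp
        moreover have "4 dvd x mod 4 - y \<Longrightarrow> 4 dvd x - y" for x y :: int by presburger
        ultimately have "4 dvd v j + (\<Sum>b\<in>B. d b * b j) - 2 * w j" by blast
        then show ?thesis by (simp add: sum_negf)
      qed
      then show ?thesis using w(1) by (intro exI[of _ "\<lambda>b. - d b"] exI[of _ w]) auto
    qed
  qed
  have "\<exists>c. v = Z4_combination I B c" if v: "v \<in> S" for v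
  proof -
    \<comment> \<open>Modulo 4, v is the combination with coefficients c plus 2 w, and w is the one
      with coefficients d plus 2 u. Substituting leaves c + 2 d, since 4 u vanishes.\<close>
    obtain c w where cw: "w \<in> S" "\<And>j. j \<in> I \<Longrightarrow> 4 dvd v j - (\<Sum>b\<in>B. c b * b j) - 2 * w j"
      using half[OF v] by blast
    obtain d u where du: "u \<in> S" "\<And>j. j \<in> I \<Longrightarrow> 4 dvd w j - (\<Sum>b\<in>B. d b * b j) - 2 * u j"
      using half[OF cw(1)] by blast
    have "v j = Z4_combination I B (\<lambda>b. c b + 2 * d b) j" for j
    proof (cases "j \<in> I")
      case True
      have "(\<Sum>b\<in>B. (c b + 2 * d b) * b j) = (\<Sum>b\<in>B. c b * b j) + 2 * (\<Sum>b\<in>B. d b * b j)"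
        by (simp add: sum_distrib_left sum.distrib algebra_simps)
      moreover have "v j \<in> {0..3}" using SI[OF v] True by auto
      moreover have "x = (s + 2 * t) mod 4"
        if "4 dvd x - s - 2 * y" "4 dvd y - t - 2 * z" "x \<in> {0..3}" for x s t y z :: int
        using that unfolding atLeastAtMost_iff by presburger
      ultimately show ?thesis
        using cw(2)[OF True] du(2)[OF True] True unfolding Z4_combination_def by simp
    next
      case False
      then show ?thesis using PiE_arb[OF SI[OF v]] by (simp add: Z4_combination_def)
    qed
    then show ?thesis by blast
  qed
  then show ?thesis using that B by blast
qed

text \<open>Independence and spanning make \<open>Z4_combination\<close> a bijection from the
  coefficient functions with values in {0..3} onto \<open>S\<close>. This is the unique
  representation demanded by \<open>free_basis\<close>, and counting both sides gives 4 ^ card B = 4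
  ^ m.\<close>

lemma free_basis_exists:
  assumes S: "submodule S Z4 (Z4_power I)" and fin: "finite S" and card: "card S = 4 ^ m"
    and even: "\<And>x. x \<in> S \<Longrightarrow> \<forall>j\<in>I. 2 dvd x j \<Longrightarrow> \<exists>w\<in>S. \<forall>j\<in>I. 4 dvd x j - 2 * w j"
  shows "\<exists>B. free_basis Z4 (Z4_power I) S B \<and> card B = m"
proof -
  obtain B where B: "B \<subseteq> S" and indep: "Z4_independent I B"
    and span: "\<And>v. v \<in> S \<Longrightarrow> \<exists>c. v = Z4_combination I B c"
    using Z4_basis_exists[OF S fin even] by blast
  have finB: "finite B" using B fin finite_subset by blast
  have inj: "inj_on (Z4_combination I B) (B \<rightarrow>\<^sub>E {0..3})"
  proof (rule inj_onI)
    fix c d assume c: "c \<in> B \<rightarrow>\<^sub>E {0..3}" and d: "d \<in> B \<rightarrow>\<^sub>E {0..3}"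
      and eq: "Z4_combination I B c = Z4_combination I B d"
    have "4 dvd (\<Sum>b\<in>B. (c b - d b) * b j)" if "j \<in> I" for j
    proof -
      have "(\<Sum>b\<in>B. c b * b j) mod 4 = (\<Sum>b\<in>B. d b * b j) mod 4"
        using fun_cong[OF eq, of j] that by (simp add: Z4_combination_def)
      then show ?thesis by (simp add: left_diff_distrib sum_subtractf mod_eq_dvd_iff)
    qed
    then have dvd: "4 dvd c b - d b" if "b \<in> B" for b
      using spec[OF indep[unfolded Z4_independent_def], of "\<lambda>b. c b - d b"] that by simp
    show "c = d"
    proof (rule PiE_ext[OF c d])
      fix b assume b: "b \<in> B"
      then have "c b \<in> {0..3}" "d b \<in> {0..3}" using c d by auto
      moreover have "x = y" if "x \<in> {0..3}" "y \<in> {0..3}" "4 dvd x - y" for x y :: int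
        using that unfolding atLeastAtMost_iff by presburger
      ultimately show "c b = d b" using dvd[OF b] by blast
    qed
  qed
  have range: "\<exists>c \<in> B \<rightarrow>\<^sub>E {0..3}. v = Z4_combination I B c" if v: "v \<in> S" for v
  proof -
    obtain c where "v = Z4_combination I B c" using span v by blast
    also have "\<dots> = Z4_combination I B (\<lambda>b\<in>B. c b mod 4)"
    proof -
      have "(\<Sum>b\<in>B. c b * b j) mod 4 = (\<Sum>b\<in>B. (\<lambda>b\<in>B. c b mod 4) b * b j) mod 4" for j
        by (subst (1 2) mod_sum_eq[symmetric]) (simp add: mod_simps cong: sum.cong)
      then show ?thesis by (simp add: Z4_combination_def)
    qed
    finally show ?thesis using mod_4_range by (intro bexI[of _ "\<lambda>b\<in>B. c b mod 4"]) auto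
  qed
  have "Z4_combination I B ` (B \<rightarrow>\<^sub>E {0..3}) = S"
    using range Z4_combination_closed[OF S finB B] by auto
  then have "card S = card (B \<rightarrow>\<^sub>E {0..3 :: int})" using inj card_image by metis
  also have "\<dots> = 4 ^ card B" using finB by (simp add: card_PiE)
  finally have "card B = m" using card by simp
  moreover have "free_basis Z4 (Z4_power I) S B"
    unfolding free_basis_def carrier_Z4
  proof (intro conjI ballI)
    fix s assume s: "s \<in> S"
    have "(\<Oplus>\<^bsub>Z4_power I\<^esub>b\<in>B. c b \<odot>\<^bsub>Z4_power I\<^esub> b) = Z4_combination I B c" for c
      using finB mod_4_range by (subst finsum_Z4_power) (auto simp: Z4_combination_def mod_sum_eq)
    then show "\<exists>!c. c \<in> B \<rightarrow>\<^sub>E {0..3} \<and> s = (\<Oplus>\<^bsub>Z4_power I\<^esub>b\<in>B. c b \<odot>\<^bsub>Z4_power I\<^esub> b)"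
      using range[OF s] inj by (auto simp: inj_on_def)
  qed (use finB B in auto)
  ultimately show ?thesis by blast
qed

section \<open>Phase vectors\<close>

lemma i_power_mod_4: "\<i> ^ (k mod 4) = \<i> ^ k"
proof -
  have "\<i> ^ k = \<i> ^ (4 * (k div 4) + k mod 4)" by simp
  also have "\<dots> = \<i> ^ (k mod 4)" unfolding power_add power_mult by simp
  finally show ?thesis ..
qed

lemma i_power_inj:
  assumes "a \<in> {0..3 :: int}" "b \<in> {0..3}" "\<i> ^ nat a = \<i> ^ nat b"
  shows "a = b"
proof -
  have "a \<in> {0, 1, 2, 3}" "b \<in> {0, 1, 2, 3}" using assms by auto
  then show ?thesis
    using assms(3) by (auto simp: numeral_3_eq_3 complex_eq_iff)
qed

lemma phase_vec_inj_on:
  assumes "finite I" "I \<noteq> {}"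
  shows "inj_on (phase_vec I) (I \<rightarrow>\<^sub>E {0..3})"
proof (rule inj_onI)
  fix x y assume x: "x \<in> I \<rightarrow>\<^sub>E {0..3}" and y: "y \<in> I \<rightarrow>\<^sub>E {0..3}"
    and eq: "phase_vec I x = phase_vec I y"
  have "card I > 0" using assms by (simp add: card_gt_0_iff)
  show "x = y"
  proof (rule PiE_ext[OF x y])
    fix j assume j: "j \<in> I"
    then have "\<i> ^ nat (x j) = \<i> ^ nat (y j)"
      using fun_cong[OF eq, of j] \<open>card I > 0\<close> by (simp add: phase_vec_def)
    then show "x j = y j" using i_power_inj x y j by blast
  qed
qed

lemma phase_exponent_phase_vec:
  assumes "finite I" "I \<noteq> {}" "x \<in> I \<rightarrow>\<^sub>E {0..3}"
  shows "phase_exponent I (phase_vec I x) = x"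
  unfolding phase_exponent_def carrier_Z4
  using phase_vec_inj_on[OF assms(1,2)] assms(3) by (intro the_equality) (auto simp: inj_on_def)

text \<open>Every entry of the product has modulus 1 / d, so the norm is 1 / sqrt d whatever the
  phases are. Dividing by it restores the factor 1 / sqrt d, and i^4 = 1 allows the added exponents
  to be reduced modulo 4.\<close>

lemma hat_mult_phase_vec:
  assumes I: "finite I" "I \<noteq> {}" and x: "x \<in> I \<rightarrow>\<^sub>E {0..3}" and y: "y \<in> I \<rightarrow>\<^sub>E {0..3}"
  shows "hat_mult I (phase_vec I x) (phase_vec I y) = phase_vec I (x \<oplus>\<^bsub>Z4_power I\<^esub> y)"
proof -
  let ?d = "real (card I)"
  let ?u = "cvec_mult I (phase_vec I x) (phase_vec I y)"
  have d: "?d > 0" using I by (simp add: card_gt_0_iff)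
  have u: "?u j = complex_of_real (1 / ?d) * \<i> ^ nat ((x j + y j) mod 4)" if "j \<in> I" for j
  proof -
    have xy: "x j \<ge> 0" "y j \<ge> 0" using x y that by (auto simp: PiE_iff)
    have "nat ((x j + y j) mod 4) = (nat (x j) + nat (y j)) mod 4"
      using xy by (simp add: nat_mod_distrib nat_add_distrib)
    then have i: "\<i> ^ nat ((x j + y j) mod 4) = \<i> ^ nat (x j) * \<i> ^ nat (y j)"
      by (simp add: i_power_mod_4 power_add)
    have "complex_of_real (1 / sqrt ?d) * complex_of_real (1 / sqrt ?d) = complex_of_real (1 / ?d)"
      using d by (simp flip: of_real_mult)
    then show ?thesis using that unfolding i by (simp add: cvec_mult_def phase_vec_def)
  qed
  have "cvec_norm I ?u = sqrt (\<Sum>j\<in>I. (1 / ?d)\<^sup>2)"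
    unfolding cvec_norm_def L2_set_def
    by (intro arg_cong[of _ _ sqrt] sum.cong) (simp_all add: u norm_mult norm_power norm_divide)
  also have "(\<Sum>j\<in>I. (1 / ?d)\<^sup>2) = 1 / ?d" using d by (simp add: power2_eq_square)
  also have "sqrt (1 / ?d) = 1 / sqrt ?d" by (simp add: real_sqrt_divide)
  finally have norm: "cvec_norm I ?u = 1 / sqrt ?d" .
  have c: "complex_of_real (1 / ?d) / complex_of_real (1 / sqrt ?d) = complex_of_real (1 / sqrt ?d)"
    using d by (simp add: field_simps flip: of_real_divide of_real_mult)
  show ?thesis
  proof
    fix j
    show "hat_mult I (phase_vec I x) (phase_vec I y) j = phase_vec I (x \<oplus>\<^bsub>Z4_power I\<^esub> y) j"
    proof (cases "j \<in> I")
      case True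
      then have "hat_mult I (phase_vec I x) (phase_vec I y) j =
          complex_of_real (1 / ?d) / complex_of_real (1 / sqrt ?d) * \<i> ^ nat ((x j + y j) mod 4)"
        unfolding hat_mult_def norm by (simp only: restrict_apply' u times_divide_eq_left)
      also have "\<dots> = phase_vec I (x \<oplus>\<^bsub>Z4_power I\<^esub> y) j"
        unfolding c using True by (simp add: phase_vec_def)
      finally show ?thesis .
    qed (simp add: hat_mult_def phase_vec_def)
  qed
qed

lemma star_phase_vec:
  assumes "finite I" "I \<noteq> {}" "x \<in> I \<rightarrow>\<^sub>E {0..3}"
  shows "star I r (phase_vec I x) = phase_vec I (r \<odot>\<^bsub>Z4_power I\<^esub> x)"
  unfolding star_def using assms by (simp add: phase_exponent_phase_vec Z4_ops)

text \<open>Transport of structure: \<open>phase_vec I\<close> carries addition and scaling of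
  exponents to \<open>hat_mult\<close> and \<open>star\<close>, so each module axiom is the image of
  the same axiom for \<open>S\<close>.\<close>

lemma module_phase_module:
  assumes I: "finite I" "I \<noteq> {}" and S: "submodule S Z4 (Z4_power I)"
  shows "Module.module Z4 (phase_module I (phase_vec I ` S))"
proof -
  interpret S: submodule S Z4 "Z4_power I" by (rule S)
  let ?V = "Z4_power I\<lparr>carrier := S\<rparr>"
  interpret V: Module.module Z4 ?V
    using S.submodule_is_module[OF module_Z4_power] .
  let ?W = "phase_module I (phase_vec I ` S)"
  have SI: "x \<in> I \<rightarrow>\<^sub>E {0..3}" if "x \<in> S" for x using S.subset that by auto
  have W: "carrier ?W = phase_vec I ` carrier ?V" "\<zero>\<^bsub>?W\<^esub> = phase_vec I \<zero>\<^bsub>?V\<^esub>"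
    by (simp_all add: phase_module_def)
  have add: "phase_vec I x \<oplus>\<^bsub>?W\<^esub> phase_vec I y = phase_vec I (x \<oplus>\<^bsub>?V\<^esub> y)"
    if "x \<in> carrier ?V" "y \<in> carrier ?V" for x y
    using hat_mult_phase_vec[OF I SI SI] that by (simp add: phase_module_def)
  have smult: "r \<odot>\<^bsub>?W\<^esub> phase_vec I x = phase_vec I (r \<odot>\<^bsub>?V\<^esub> x)" if "x \<in> carrier ?V" for r x
    using star_phase_vec[OF I SI] that by (simp add: phase_module_def)
  show ?thesis
  proof (rule moduleI)
    show "abelian_group ?W"
    proof (rule abelian_groupI)
      fix x assume "x \<in> carrier ?W"
      then obtain x' where x': "x' \<in> carrier ?V" "x = phase_vec I x'" unfolding W by blast
      have "phase_vec I (\<ominus>\<^bsub>?V\<^esub> x') \<oplus>\<^bsub>?W\<^esub> x = \<zero>\<^bsub>?W\<^esub>"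
        unfolding W x'(2) using x'(1) by (simp only: add V.M.a_inv_closed V.M.l_neg)
      then show "\<exists>y \<in> carrier ?W. y \<oplus>\<^bsub>?W\<^esub> x = \<zero>\<^bsub>?W\<^esub>"
        unfolding W using V.M.a_inv_closed[OF x'(1)] by blast
    qed (unfold W, ((elim imageE)?, simp only: add V.M.a_closed V.M.zero_closed V.M.l_zero V.M.r_zero
           imageI V.M.a_ac)+)
  qed (unfold W, (rule cring_Z4 | (elim imageE, simp only: add smult V.smult_closed V.M.a_closed
         imageI V.smult_l_distr V.smult_r_distr V.smult_assoc1 V.smult_one V.R.a_closed
         V.R.m_closed V.R.one_closed))+)
qed

section \<open>Teichmueller digits and the Frobenius map\<close>

locale galois_ring_teichmueller = cring R for R :: "('a, 'b) ring_scheme" (structure) +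
  fixes n :: nat and \<xi> :: 'a and T :: "'a set"
  assumes n_pos: "n \<ge> 1"
    and galois: "galois_ring4 n R"
    and xi_unit: "\<xi> \<in> Units R"
    and ord_xi: "group.ord (units_of R) \<xi> = 2 ^ n - 1"
    and T_def: "T = teichmueller R n \<xi>"
begin

abbreviation tw :: 'a where "tw \<equiv> two R"
abbreviation q :: nat where "q \<equiv> 2 ^ n - 1"
abbreviation \<phi> :: "'a \<Rightarrow> 'a" where "\<phi> \<equiv> frobenius R T"

section \<open>Arithmetic modulo 2 in the ring\<close>

lemma finite_carrier: "finite (carrier R)" and card_carrier: "card (carrier R) = 4 ^ n"
  using galois by (auto simp: galois_ring4_def)

lemma two_closed [simp, intro]: "tw \<in> carrier R"
  by (simp add: two_def)

text \<open>Characteristic 4 enters here. The equivalence yields 2 * 2 = 0 and 2 \<noteq> 0, makes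
  the integer behind \<open>tr4\<close> unique, and turns the end of the nondegeneracy proof into a
  parity question.\<close>

lemma int_multiple_eq_iff: "[k] \<cdot> \<one> = [l] \<cdot> \<one> \<longleftrightarrow> 4 dvd l - (k :: int)"
proof -
  have "group.ord (add_monoid R) \<one> = 4"
    using galois by (simp add: galois_ring4_def)
  then show ?thesis
    using add.int_pow_eq[of \<one> k l] by (simp add: add_pow_def)
qed

lemma two_multiple: "[(2 :: int)] \<cdot> \<one> = tw"
proof -
  have "[(2 :: int)] \<cdot> \<one> = [nat 2] \<cdot> \<one>"
    by (rule add_pow_int_ge) simp
  also have "\<dots> = tw"
    by (simp add: numeral_2_eq_2 two_def)
  finally show ?thesis .
qed

lemma zero_multiple: "[(0 :: int)] \<cdot> \<one> = \<zero>"
  by (simp add: add_pow_def int_pow_def nat_pow_def)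

lemma two_mult_two: "tw \<otimes> tw = \<zero>"
proof -
  have "tw \<otimes> tw = [(4 :: int)] \<cdot> \<one>"
    unfolding two_multiple[symmetric]
    by (simp add: add_pow_ldistr_int add.int_pow_pow)
  also have "\<dots> = [(0 :: int)] \<cdot> \<one>"
    by (simp only: int_multiple_eq_iff) simp
  finally show ?thesis by (simp only: zero_multiple)
qed

lemma two_neq_zero: "tw \<noteq> \<zero>"
  using int_multiple_eq_iff[of 2 0] two_multiple zero_multiple by simp

lemma two_mult_two_left: "x \<in> carrier R \<Longrightarrow> tw \<otimes> (tw \<otimes> x) = \<zero>"
  by (simp add: m_assoc[symmetric] two_mult_two)

text \<open>The Galois ring condition on zero divisors enters here. It stands in for a residue
  field: evenness of x is shown by exhibiting a nonzero y that annihilates it.\<close>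

lemma zero_divisor_imp_even:
  assumes "x \<in> carrier R" "y \<in> carrier R" "y \<noteq> \<zero>" "x \<otimes> y = \<zero>"
  obtains z where "z \<in> carrier R" "x = tw \<otimes> z"
proof -
  have "x \<in> zero_divisors R \<union> {\<zero>}"
    using assms by (auto simp: zero_divisors_def)
  then have "x \<in> PIdl tw"
    using galois unfolding galois_ring4_def by blast
  then show ?thesis
    using that by (auto simp: cgenideal_def m_comm)
qed

lemma two_annihilator:
  assumes "x \<in> carrier R" "tw \<otimes> x = \<zero>"
  obtains z where "z \<in> carrier R" "x = tw \<otimes> z"
  using zero_divisor_imp_even[of x tw] assms two_neq_zero by (metis m_comm two_closed)

section \<open>Powers of the generator and Teichmueller digits\<close>

lemma xi_closed [simp, intro]: "\<xi> \<in> carrier R"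
  using xi_unit by auto

lemma xi_pow_eq_one_iff: "\<xi> [^] (k :: nat) = \<one> \<longleftrightarrow> q dvd k"
proof -
  interpret U: group "units_of R" by (rule units_group)
  have "\<xi> [^] k = \<xi> [^]\<^bsub>units_of R\<^esub> k"
    using units_of_pow[OF xi_unit] by simp
  then show ?thesis
    using U.pow_eq_id[of \<xi> k] xi_unit ord_xi by (simp add: units_of_carrier units_of_one)
qed

lemma q_pos: "q \<ge> 1" and q_odd: "odd q"
proof -
  have "(2 :: nat) ^ n = 2 * 2 ^ (n - 1)" using n_pos by (simp add: power_eq_if)
  moreover have "(2 :: nat) ^ (n - 1) \<ge> 1" by simp
  ultimately show "q \<ge> 1" "odd q" by presburger+
qed

lemma xi_pow_mod: "\<xi> [^] k = \<xi> [^] (k mod q)"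
proof -
  have "\<xi> [^] k = \<xi> [^] (q * (k div q) + k mod q)" by simp
  also have "\<dots> = (\<xi> [^] q) [^] (k div q) \<otimes> \<xi> [^] (k mod q)"
    by (simp only: nat_pow_mult[symmetric] nat_pow_pow[symmetric] xi_closed)
  finally show ?thesis using xi_pow_eq_one_iff[of q] by simp
qed

lemma xi_pow_inverse_pow: "\<xi> [^] (k :: nat) \<otimes> \<xi> [^] (k * (q - 1)) = \<one>"
proof -
  have "\<xi> [^] k \<otimes> \<xi> [^] (k * (q - 1)) = \<xi> [^] (k + k * (q - 1))"
    by (simp only: nat_pow_mult xi_closed)
  also have "k + k * (q - 1) = k * q"
    using q_pos by (metis One_nat_def Suc_pred' mult_Suc_right less_eq_Suc_le)
  also have "\<xi> [^] (k * q) = \<one>" by (simp only: xi_pow_eq_one_iff) simp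
  finally show ?thesis .
qed

lemma xi_pow_inverse: "\<exists>v \<in> carrier R. \<xi> [^] (k :: nat) \<otimes> v = \<one>"
  using xi_pow_inverse_pow[of k] nat_pow_closed[OF xi_closed] by blast

lemma T_iff: "x \<in> T \<longleftrightarrow> x = \<zero> \<or> (\<exists>k :: nat. x = \<xi> [^] k)"
proof -
  have "\<xi> [^] k \<in> T" for k :: nat
    unfolding T_def teichmueller_def using xi_pow_mod[of k] q_pos
    by (metis (mono_tags, lifting) UnCI mem_Collect_eq mod_less_divisor less_eq_Suc_le One_nat_def)
  then show ?thesis by (auto simp: T_def teichmueller_def)
qed

lemma T_closed: "x \<in> T \<Longrightarrow> x \<in> carrier R"
  by (auto simp: T_iff)

lemma zero_in_T [simp]: "\<zero> \<in> T"
  by (simp add: T_iff)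

lemma one_in_T [simp]: "\<one> \<in> T"
  unfolding T_iff by (metis nat_pow_0)

lemma T_mult_closed: "x \<in> T \<Longrightarrow> y \<in> T \<Longrightarrow> x \<otimes> y \<in> T"
  unfolding T_iff by (auto simp: nat_pow_mult)

lemma finite_T: "finite T"
  using finite_carrier T_closed by (meson finite_subset subsetI)

text \<open>Both correction terms carry a factor 4, so squaring sees only the class modulo
  2.\<close>

lemma square_cong_two:
  assumes "a \<in> carrier R" "b \<in> carrier R"
  shows "(a \<oplus> tw \<otimes> b) \<otimes> (a \<oplus> tw \<otimes> b) = a \<otimes> a"
proof -
  have "(a \<oplus> tw \<otimes> b) \<otimes> (a \<oplus> tw \<otimes> b) = a \<otimes> a \<oplus> (tw \<otimes> tw) \<otimes> (a \<otimes> b \<oplus> b \<otimes> b)"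
    using assms unfolding two_def by algebra
  then show ?thesis using assms by (simp add: two_mult_two)
qed

text \<open>Squaring is additive modulo 2, and the factor 2 turns that congruence into an
  equality.\<close>

lemma two_mult_square_add:
  assumes "x \<in> carrier R" "y \<in> carrier R"
  shows "tw \<otimes> ((x \<oplus> y) \<otimes> (x \<oplus> y)) = tw \<otimes> (x \<otimes> x) \<oplus> tw \<otimes> (y \<otimes> y)"
proof -
  have "tw \<otimes> ((x \<oplus> y) \<otimes> (x \<oplus> y)) = tw \<otimes> (x \<otimes> x) \<oplus> tw \<otimes> (y \<otimes> y) \<oplus> (tw \<otimes> tw) \<otimes> (x \<otimes> y)"
    using assms unfolding two_def by algebra
  then show ?thesis using assms by (simp add: two_mult_two)
qed

text \<open>Squaring erases the even part and gives \<xi>^(2k) = 1; since the order \<open>q\<close>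
  is odd, the 2 cancels.\<close>

lemma xi_pow_cong_one:
  assumes "\<xi> [^] (k :: nat) = \<one> \<oplus> tw \<otimes> z" "z \<in> carrier R"
  shows "\<xi> [^] k = \<one>"
proof -
  have "\<xi> [^] (k + k) = \<one>"
    using square_cong_two[of \<one> z] assms by (simp flip: nat_pow_mult)
  then have "q dvd 2 * k" by (simp only: xi_pow_eq_one_iff mult_2)
  then have "q dvd k" using q_odd by (metis coprime_dvd_mult_right_iff coprime_right_2_iff_odd)
  then show ?thesis by (simp add: xi_pow_eq_one_iff)
qed

lemma xi_pow_not_even:
  assumes "z \<in> carrier R"
  shows "\<xi> [^] (k :: nat) \<noteq> tw \<otimes> z"
proof
  assume *: "\<xi> [^] k = tw \<otimes> z"
  obtain v where v: "v \<in> carrier R" "\<xi> [^] k \<otimes> v = \<one>" using xi_pow_inverse by blast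
  have "tw = tw \<otimes> (tw \<otimes> z \<otimes> v)" using v * by simp
  also have "\<dots> = \<zero>" using assms v by (simp add: m_assoc two_mult_two_left)
  finally show False using two_neq_zero by simp
qed

text \<open>Each class modulo 2 contains at most one Teichmueller element: the quotient of two
  congruent nonzero ones is a power of \<xi> congruent to 1, hence equal to 1.\<close>

lemma T_cong_two:
  assumes "a \<in> T" "b \<in> T" "z \<in> carrier R" "a = b \<oplus> tw \<otimes> z"
  shows "a = b"
proof (cases "b = \<zero>")
  case True
  then have "a = tw \<otimes> z" using assms by simp
  then show ?thesis using True assms xi_pow_not_even[of z] by (metis T_iff)
next
  case False
  then obtain l where l: "b = \<xi> [^] (l :: nat)" using assms by (auto simp: T_iff)
  show ?thesis
  proof (cases "a = \<zero>")
    case True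
    have "b = tw \<otimes> (\<ominus> z)"
      using True assms T_closed[OF assms(2)] l
      by (metis r_minus two_closed minus_equality a_comm m_closed a_inv_closed minus_minus)
    then show ?thesis using xi_pow_not_even[of "\<ominus> z" l] l assms by simp
  next
    case False
    then obtain k where k: "a = \<xi> [^] (k :: nat)" using assms by (auto simp: T_iff)
    \<comment> \<open>The exponent of a / b, because l * (q - 1) is an exponent of the inverse of
      \<xi>^l.\<close>
    define m where "m = k + l * (q - 1)"
    define w where "w = \<xi> [^] (l * (q - 1))"
    have w: "w \<in> carrier R" "b \<otimes> w = \<one>" using xi_pow_inverse_pow[of l] by (auto simp: w_def l)
    have "\<xi> [^] m = a \<otimes> w" unfolding m_def k w_def by (simp only: nat_pow_mult xi_closed)
    also have "\<dots> = b \<otimes> w \<oplus> tw \<otimes> (z \<otimes> w)"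
      using assms w T_closed[OF assms(2)] by (simp add: l_distr m_assoc)
    finally have "\<xi> [^] m = \<one> \<oplus> tw \<otimes> (z \<otimes> w)" using w by simp
    then have "\<xi> [^] m = \<one>" using xi_pow_cong_one[of m "z \<otimes> w"] assms w by simp
    then have "a \<otimes> w = b \<otimes> w" using \<open>\<xi> [^] m = a \<otimes> w\<close> w by simp
    then have "a \<otimes> (w \<otimes> b) = b \<otimes> (w \<otimes> b)"
      using assms(1,2) w T_closed by (simp flip: m_assoc)
    then show ?thesis using assms(1,2) w T_closed by (simp add: m_comm)
  qed
qed

lemma card_T: "card T = 2 ^ n"
proof -
  have inj: "inj_on (\<lambda>k :: nat. \<xi> [^] k) {..<q}"
  proof (rule linorder_inj_onI')
    fix i j :: nat assume ij: "i \<in> {..<q}" "j \<in> {..<q}" "i < j"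
    show "\<xi> [^] i \<noteq> \<xi> [^] j"
    proof
      assume "\<xi> [^] i = \<xi> [^] j"
      then have "\<xi> [^] i \<otimes> \<xi> [^] (j - i) = \<xi> [^] i \<otimes> \<one>"
        using ij nat_pow_mult[OF xi_closed, of i "j - i"] by simp
      moreover obtain v where "v \<in> carrier R" "\<xi> [^] i \<otimes> v = \<one>" using xi_pow_inverse by blast
      ultimately have "\<xi> [^] (j - i) = \<one>"
        by (metis m_comm m_assoc l_one nat_pow_closed xi_closed one_closed)
      then have "q dvd j - i" by (simp only: xi_pow_eq_one_iff)
      then show False using ij by (auto dest!: dvd_imp_le)
    qed
  qed
  have "T = insert \<zero> ((\<lambda>k :: nat. \<xi> [^] k) ` {..<q})"
    by (auto simp: T_def teichmueller_def)
  moreover have "\<zero> \<notin> (\<lambda>k :: nat. \<xi> [^] k) ` {..<q}"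
    using xi_pow_not_even[OF zero_closed] by (metis (no_types, lifting) imageE r_null two_closed)
  ultimately have "card T = Suc q" using inj by (simp add: card_image)
  then show ?thesis by simp
qed

text \<open>Reduction modulo 2 determines the first digit. The difference of the second digits is
  then killed by 2, hence even, so these digits are congruent and equal as well.\<close>

lemma digits_unique:
  assumes "a \<in> T" "b \<in> T" "a' \<in> T" "b' \<in> T" "a \<oplus> tw \<otimes> b = a' \<oplus> tw \<otimes> b'"
  shows "a = a' \<and> b = b'"
proof -
  note cl [simp] = assms(1-4)[THEN T_closed]
  have "a = (a \<oplus> tw \<otimes> b) \<ominus> tw \<otimes> b" using cl two_closed by algebra
  also have "\<dots> = a' \<oplus> tw \<otimes> (b' \<ominus> b)" unfolding assms(5) using cl two_closed by algebra
  finally have a: "a = a'" using T_cong_two[of a a' "b' \<ominus> b"] assms by simp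
  then have "tw \<otimes> b = tw \<otimes> b'" using assms(5) by simp
  then have "tw \<otimes> (b \<ominus> b') = \<zero>" by (simp add: r_distr minus_eq r_minus r_neg)
  then obtain z where z: "z \<in> carrier R" "b \<ominus> b' = tw \<otimes> z" using two_annihilator[of "b \<ominus> b'"] by auto
  have "b = b' \<oplus> (b \<ominus> b')" using cl by algebra
  then show ?thesis using T_cong_two[of b b' z] a z assms by simp
qed

text \<open>By counting: there are 2^n * 2^n pairs of digits, they give distinct elements, and the
  ring has 4^n of them.\<close>

lemma digits_exist:
  assumes "y \<in> carrier R"
  obtains a b where "a \<in> T" "b \<in> T" "y = a \<oplus> tw \<otimes> b"
proof -
  let ?f = "\<lambda>(a, b). a \<oplus> tw \<otimes> b"
  have "inj_on ?f (T \<times> T)" unfolding inj_on_def using digits_unique by simp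
  then have "card (?f ` (T \<times> T)) = card (carrier R)"
    using power_mult_distrib[of "2 :: nat" 2 n]
    by (simp add: card_image card_cartesian_product card_T card_carrier)
  moreover have "?f ` (T \<times> T) \<subseteq> carrier R" using T_closed by auto
  ultimately have "?f ` (T \<times> T) = carrier R" using finite_carrier by (intro card_subset_eq)
  then have "y \<in> ?f ` (T \<times> T)" using assms by simp
  then show ?thesis using that by auto
qed

section \<open>The Frobenius map: additivity, iterates, fixed elements\<close>

lemma frobenius_digits:
  assumes "a \<in> T" "b \<in> T"
  shows "\<phi> (a \<oplus> tw \<otimes> b) = a \<otimes> a \<oplus> tw \<otimes> (b \<otimes> b)"
  unfolding frobenius_def from_digits_def
proof (rule the_equality)
  show "\<exists>a'\<in>T. \<exists>b'\<in>T. a \<oplus> tw \<otimes> b = a' \<oplus> tw \<otimes> b' \<and>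
          a \<otimes> a \<oplus> tw \<otimes> (b \<otimes> b) = a' [^] (2::nat) \<oplus> tw \<otimes> b' [^] (2::nat)"
    using assms T_closed by (auto simp: numeral_2_eq_2)
next
  fix z
  assume "\<exists>a'\<in>T. \<exists>b'\<in>T. a \<oplus> tw \<otimes> b = a' \<oplus> tw \<otimes> b' \<and> z = a' [^] (2::nat) \<oplus> tw \<otimes> b' [^] (2::nat)"
  then show "z = a \<otimes> a \<oplus> tw \<otimes> (b \<otimes> b)"
    using assms T_closed digits_unique[of a b] by (auto simp: numeral_2_eq_2)
qed

text \<open>Replacing the second digit by any element of its class modulo 2 changes neither 2 z nor
  z^2. This avoids normalising carries when sums are formed.\<close>

lemma frobenius_digit_rest:
  assumes "a \<in> T" "z \<in> carrier R"
  shows "\<phi> (a \<oplus> tw \<otimes> z) = a \<otimes> a \<oplus> tw \<otimes> (z \<otimes> z)"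
proof -
  obtain b b' where b: "b \<in> T" "b' \<in> T" "z = b \<oplus> tw \<otimes> b'" using digits_exist assms by blast
  then have "tw \<otimes> z = tw \<otimes> b" using T_closed by (simp add: r_distr two_mult_two_left)
  moreover have "z \<otimes> z = b \<otimes> b" using b T_closed by (simp add: square_cong_two)
  ultimately show ?thesis using frobenius_digits assms b by simp
qed

lemma frobenius_closed [simp]: "y \<in> carrier R \<Longrightarrow> \<phi> y \<in> carrier R"
  by (erule digits_exist) (simp add: frobenius_digits T_closed)

text \<open>Since 2^n = q + 1, raising to the power 2^(n-1) and then squaring is the identity on
  \<open>T\<close>.\<close>

lemma T_sqrt:
  assumes "a \<in> T"
  obtains s where "s \<in> T" "a = s \<otimes> s"
proof (cases "a = \<zero>")
  case True
  then show ?thesis using that[of \<zero>] by simp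
next
  case False
  then obtain k where k: "a = \<xi> [^] (k :: nat)" using assms by (auto simp: T_iff)
  have "\<xi> [^] (k * 2 ^ (n - 1)) \<otimes> \<xi> [^] (k * 2 ^ (n - 1)) = \<xi> [^] (k * 2 ^ n)"
    using n_pos by (simp add: nat_pow_mult mult_2[symmetric] power_eq_if ac_simps)
  also have "k * 2 ^ n = k + k * q"
    by (simp add: algebra_simps)
  also have "\<xi> [^] (k + k * q) = \<xi> [^] k \<otimes> \<xi> [^] (k * q)"
    by (simp only: nat_pow_mult xi_closed)
  also have "\<xi> [^] (k * q) = \<one>" by (simp only: xi_pow_eq_one_iff) simp
  finally show ?thesis using that[of "\<xi> [^] (k * 2 ^ (n - 1))"] k T_iff by auto
qed

text \<open>
  For \<open>s, u\<close> in the Teichmueller set, \<open>s\<^sup>2 + u\<^sup>2 = (s + u)\<^sup>2 + 2 s u\<close> because 4 vanishes, and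
  \<open>(s + u)\<^sup>2\<close> is again in the Teichmueller set.
\<close>

lemma frobenius_add:
  assumes "x \<in> carrier R" "y \<in> carrier R"
  shows "\<phi> (x \<oplus> y) = \<phi> x \<oplus> \<phi> y"
proof -
  obtain a b where x: "a \<in> T" "b \<in> T" "x = a \<oplus> tw \<otimes> b" using digits_exist assms by blast
  obtain a' b' where y: "a' \<in> T" "b' \<in> T" "y = a' \<oplus> tw \<otimes> b'" using digits_exist assms by blast
  obtain s where s: "s \<in> T" "a = s \<otimes> s" using T_sqrt x by blast
  obtain u where u: "u \<in> T" "a' = u \<otimes> u" using T_sqrt y by blast
  have cl [simp]: "s \<in> carrier R" "u \<in> carrier R" "b \<in> carrier R" "b' \<in> carrier R"
    using s u x y T_closed by auto
  obtain c e where c: "c \<in> T" "e \<in> T" "s \<oplus> u = c \<oplus> tw \<otimes> e" using digits_exist[of "s \<oplus> u"] by auto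
  then have cc: "(s \<oplus> u) \<otimes> (s \<oplus> u) = c \<otimes> c" using T_closed by (simp add: square_cong_two)
  \<comment> \<open>The total carry: x + y = c^2 + 2 z up to a multiple of 4, with c^2 in
    \<open>T\<close>. As \<open>z\<close> need not be a digit, \<open>frobenius_digit_rest\<close>
    evaluates the Frobenius map.\<close>
  define z where "z = s \<otimes> u \<oplus> b \<oplus> b'"
  have z: "z \<in> carrier R" by (simp add: z_def)
  have aa: "a \<in> carrier R" "a' \<in> carrier R" using x y T_closed by auto
  have su: "(s \<oplus> u) \<otimes> (s \<oplus> u) = a \<oplus> a' \<oplus> tw \<otimes> (s \<otimes> u)"
    unfolding s(2) u(2) two_def using cl by algebra
  have "(s \<oplus> u) \<otimes> (s \<oplus> u) \<oplus> tw \<otimes> z = x \<oplus> y \<oplus> (tw \<otimes> tw) \<otimes> (s \<otimes> u)"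
    unfolding z_def x(3) y(3) su unfolding two_def using cl aa by algebra
  then have "x \<oplus> y = c \<otimes> c \<oplus> tw \<otimes> z" using assms by (simp add: cc two_mult_two)
  then have "\<phi> (x \<oplus> y) = (c \<otimes> c) \<otimes> (c \<otimes> c) \<oplus> tw \<otimes> (z \<otimes> z)"
    using frobenius_digit_rest[of "c \<otimes> c" z] z T_mult_closed c by simp
  also have "(c \<otimes> c) \<otimes> (c \<otimes> c) = (a \<oplus> a') \<otimes> (a \<oplus> a')"
    unfolding cc[symmetric] su using aa by (simp add: square_cong_two)
  also have "tw \<otimes> (z \<otimes> z) = tw \<otimes> (a \<otimes> a') \<oplus> tw \<otimes> (b \<otimes> b) \<oplus> tw \<otimes> (b' \<otimes> b')"
  proof -
    have "(s \<otimes> u) \<otimes> (s \<otimes> u) = a \<otimes> a'" unfolding s(2) u(2) using cl by algebra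
    then show ?thesis unfolding z_def by (simp add: two_mult_square_add)
  qed
  \<comment> \<open>The cross term 2 a a' of the square meets the 2 a a' coming from the carry, and
    together they vanish as 4 a a'.\<close>
  also have "(a \<oplus> a') \<otimes> (a \<oplus> a') \<oplus> (tw \<otimes> (a \<otimes> a') \<oplus> tw \<otimes> (b \<otimes> b) \<oplus> tw \<otimes> (b' \<otimes> b'))
      = (a \<otimes> a \<oplus> tw \<otimes> (b \<otimes> b)) \<oplus> (a' \<otimes> a' \<oplus> tw \<otimes> (b' \<otimes> b')) \<oplus> (tw \<otimes> tw) \<otimes> (a \<otimes> a')"
    unfolding two_def using cl aa by algebra
  also have "\<dots> = \<phi> x \<oplus> \<phi> y"
    using x(1,2) y(1,2) aa unfolding x(3) y(3) by (simp add: two_mult_two frobenius_digits)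
  finally show ?thesis .
qed

lemma T_pow_closed: "a \<in> T \<Longrightarrow> a [^] (k :: nat) \<in> T"
  by (induction k) (auto simp: T_mult_closed)

lemma T_pow_two_pow_n:
  assumes "a \<in> T"
  shows "a [^] (2 ^ n :: nat) = a"
proof (cases "a = \<zero>")
  case True
  then show ?thesis by (simp add: nat_pow_zero)
next
  case False
  then obtain k where k: "a = \<xi> [^] (k :: nat)" using assms by (auto simp: T_iff)
  have "a [^] (2 ^ n :: nat) = \<xi> [^] (k + k * q)"
    unfolding k by (simp add: nat_pow_pow algebra_simps)
  also have "\<dots> = \<xi> [^] k \<otimes> \<xi> [^] (k * q)"
    by (simp only: nat_pow_mult xi_closed)
  also have "\<xi> [^] (k * q) = \<one>" by (simp only: xi_pow_eq_one_iff) simp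
  finally show ?thesis using k by simp
qed

lemma frobenius_funpow_digits:
  assumes "a \<in> T" "b \<in> T"
  shows "(\<phi> ^^ j) (a \<oplus> tw \<otimes> b) = a [^] (2 ^ j :: nat) \<oplus> tw \<otimes> b [^] (2 ^ j :: nat)"
proof (induction j)
  case 0
  then show ?case using assms T_closed by simp
next
  case (Suc j)
  have "a [^] (2 ^ j :: nat) \<otimes> a [^] (2 ^ j :: nat) = a [^] (2 ^ Suc j :: nat)"
       "b [^] (2 ^ j :: nat) \<otimes> b [^] (2 ^ j :: nat) = b [^] (2 ^ Suc j :: nat)"
    using assms T_closed by (simp_all add: nat_pow_mult mult_2)
  then show ?case using Suc assms T_pow_closed by (simp add: frobenius_digits del: power_Suc)
qed

lemma frobenius_funpow_closed: "y \<in> carrier R \<Longrightarrow> (\<phi> ^^ j) y \<in> carrier R"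
  by (induction j) auto

lemma frobenius_funpow_add:
  "x \<in> carrier R \<Longrightarrow> y \<in> carrier R \<Longrightarrow> (\<phi> ^^ j) (x \<oplus> y) = (\<phi> ^^ j) x \<oplus> (\<phi> ^^ j) y"
  by (induction j) (auto simp: frobenius_add frobenius_funpow_closed)

lemma frobenius_funpow_n: "y \<in> carrier R \<Longrightarrow> (\<phi> ^^ n) y = y"
  by (erule digits_exist) (simp add: frobenius_funpow_digits T_pow_two_pow_n)

text \<open>By uniqueness, the digits of a fixed element are idempotent. Nonzero elements of
  \<open>T\<close> are units, so each digit is 0 or 1, and the four combinations are the multiples
  0, 1, 2, 3 of 1. This places the trace in the prime subring.\<close>

lemma frobenius_fixed:
  assumes "y \<in> carrier R" "\<phi> y = y"
  shows "\<exists>k \<in> {0..3 :: int}. y = [k] \<cdot> \<one>"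
proof -
  obtain a b where y: "a \<in> T" "b \<in> T" "y = a \<oplus> tw \<otimes> b" using digits_exist assms by blast
  have "a \<otimes> a = a \<and> b \<otimes> b = b"
    using digits_unique[of "a \<otimes> a" "b \<otimes> b" a b] T_mult_closed y assms
    by (simp add: frobenius_digits)
  moreover have "x = \<zero> \<or> x = \<one>" if x: "x \<in> T" "x \<otimes> x = x" for x
  proof (cases "x = \<zero>")
    case False
    then obtain k where k: "x = \<xi> [^] (k :: nat)" using x by (auto simp: T_iff)
    then obtain v where v: "v \<in> carrier R" "x \<otimes> v = \<one>" using xi_pow_inverse by blast
    have "x = x \<otimes> (x \<otimes> v)" unfolding v(2) using x T_closed by simp
    also have "\<dots> = (x \<otimes> x) \<otimes> v" using v(1) x(1) T_closed by (simp add: m_assoc)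
    also have "\<dots> = \<one>" using v x by simp
    finally show ?thesis ..
  qed simp
  ultimately have ab: "a = \<zero> \<or> a = \<one>" "b = \<zero> \<or> b = \<one>" using y by auto
  have "[(1 :: int)] \<cdot> \<one> = \<one>" by simp
  moreover have "[(3 :: int)] \<cdot> \<one> = \<one> \<oplus> tw"
    using add.int_pow_mult[of \<one> 1 2] by (simp add: two_multiple)
  ultimately show ?thesis
    using ab unfolding y(3)
    by (elim disjE) (force intro: bexI[of _ 0] bexI[of _ 1] bexI[of _ 2] bexI[of _ 3] simp: two_multiple zero_multiple)+
qed

subsection \<open>The trace\<close>

abbreviation tr :: "'a \<Rightarrow> 'a" where "tr \<equiv> trace R n T"

lemma trace_partial_closed: "y \<in> carrier R \<Longrightarrow> (\<Oplus> j \<in> {..<m}. (\<phi> ^^ j) y) \<in> carrier R"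
  by (intro finsum_closed) (auto simp: frobenius_funpow_closed)

lemma trace_partial_Suc:
  assumes "y \<in> carrier R"
  shows "(\<Oplus> j \<in> {..<Suc m}. (\<phi> ^^ j) y) = (\<phi> ^^ m) y \<oplus> (\<Oplus> j \<in> {..<m}. (\<phi> ^^ j) y)"
  unfolding lessThan_Suc using assms frobenius_funpow_closed
  by (subst finsum_insert) auto

lemma trace_closed [simp]: "y \<in> carrier R \<Longrightarrow> tr y \<in> carrier R"
  by (simp add: trace_def trace_partial_closed)

lemma trace_add:
  assumes "x \<in> carrier R" "y \<in> carrier R"
  shows "tr (x \<oplus> y) = tr x \<oplus> tr y"
  unfolding trace_def using assms frobenius_funpow_closed
  by (simp add: frobenius_funpow_add finsum_addf Pi_def)

text \<open>The sum of the first n + 1 iterates is computed in two ways, splitting off the first or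
  the last term. Both of these are y, since the n-th iterate is the identity, so y cancels.\<close>

lemma frobenius_trace:
  assumes "y \<in> carrier R"
  shows "\<phi> (tr y) = tr y"
proof -
  let ?S = "\<lambda>m. \<Oplus> j \<in> {..<m}. (\<phi> ^^ j) y"
  have zero: "\<phi> \<zero> = \<zero>" using frobenius_digits[of \<zero> \<zero>] by simp
  have S: "?S (Suc m) = \<phi> (?S m) \<oplus> y" for m
  proof (induction m)
    case 0
    then show ?case using assms zero trace_partial_Suc[of y 0] by simp
  next
    case (Suc m)
    have "?S (Suc (Suc m)) = \<phi> ((\<phi> ^^ m) y) \<oplus> (\<phi> (?S m) \<oplus> y)"
      using trace_partial_Suc[OF assms, of "Suc m"] Suc by simp
    also have "\<dots> = \<phi> ((\<phi> ^^ m) y \<oplus> ?S m) \<oplus> y"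
      using assms trace_partial_closed[OF assms, of m] frobenius_funpow_closed[OF assms, of m]
      by (simp add: frobenius_add a_assoc)
    finally show ?case using trace_partial_Suc[OF assms] by simp
  qed
  have "\<phi> (tr y) \<oplus> y = y \<oplus> tr y"
    using S[of n] trace_partial_Suc[OF assms, of n] frobenius_funpow_n[OF assms] by (simp add: trace_def)
  then show ?thesis using assms by (simp add: a_comm[of y])
qed

lemma tr4_props:
  assumes "y \<in> carrier R"
  shows tr4_range: "tr4 R n T y \<in> {0..3}" and tr4_trace: "[tr4 R n T y] \<cdot> \<one> = tr y"
proof -
  have Z4: "carrier Z4 = {0..3}" by (simp add: residue_ring_def)
  obtain k where k: "k \<in> {0..3 :: int}" "tr y = [k] \<cdot> \<one>"
    using frobenius_fixed[OF trace_closed frobenius_trace] assms by blast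
  have "tr4 R n T y = k"
    unfolding tr4_def Z4
  proof (rule the_equality)
    fix l :: int assume "l \<in> {0..3} \<and> [l] \<cdot> \<one> = tr y"
    then show "l = k" using k int_multiple_eq_iff[of l k] by (auto; presburger)
  qed (use k in auto)
  then show "tr4 R n T y \<in> {0..3}" "[tr4 R n T y] \<cdot> \<one> = tr y" using k by auto
qed

lemma tr4_add:
  assumes "x \<in> carrier R" "y \<in> carrier R"
  shows "tr4 R n T (x \<oplus> y) = (tr4 R n T x + tr4 R n T y) mod 4"
proof -
  let ?t = "tr4 R n T"
  have "[?t (x \<oplus> y)] \<cdot> \<one> = [(?t x + ?t y)] \<cdot> \<one>"
    using assms by (simp add: tr4_trace trace_add add.int_pow_mult)
  then have "4 dvd ?t x + ?t y - ?t (x \<oplus> y)" by (simp only: int_multiple_eq_iff)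
  then show ?thesis using tr4_range[of "x \<oplus> y"] assms by (simp; presburger)
qed

section \<open>Nondegeneracy of the trace form\<close>

lemma geometric_sum_xi:
  assumes "\<not> q dvd e"
  shows "(\<Oplus> k \<in> {..<q}. (\<xi> [^] (e :: nat)) [^] k) = \<zero>"
proof -
  define g where "g = \<xi> [^] e"
  have g: "g \<in> carrier R" by (simp add: g_def)
  let ?G = "\<lambda>m. \<Oplus> k \<in> {..<m :: nat}. g [^] k"
  have G: "?G m \<in> carrier R" for m by (intro finsum_closed) (auto simp: g)
  have GSuc: "?G (Suc m) = g [^] m \<oplus> ?G m" for m
    unfolding lessThan_Suc by (subst finsum_insert) (auto simp: g)
  have step: "g \<otimes> ?G m \<oplus> \<one> = ?G m \<oplus> g [^] m" for m
  proof (induction m)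
    case (Suc m)
    have "g \<otimes> ?G (Suc m) \<oplus> \<one> = g [^] Suc m \<oplus> (g \<otimes> ?G m \<oplus> \<one>)"
      using g G[of m] by (simp add: GSuc r_distr m_comm a_assoc)
    also have "\<dots> = ?G (Suc m) \<oplus> g [^] Suc m"
      unfolding Suc GSuc using g G[of m] by (simp add: a_ac)
    finally show ?case .
  qed (simp add: g)
  have "g [^] q = \<xi> [^] (e * q)" unfolding g_def by (simp only: nat_pow_pow xi_closed)
  also have "\<dots> = \<one>" by (simp only: xi_pow_eq_one_iff) simp
  finally have "g \<otimes> ?G q = ?G q" using step[of q] g G[of q] by simp
  moreover have "(g \<ominus> \<one>) \<otimes> ?G q = g \<otimes> ?G q \<ominus> ?G q" using g G[of q] by algebra
  ultimately have eq: "(g \<ominus> \<one>) \<otimes> ?G q = \<zero>" using G[of q] by (simp add: minus_eq r_neg)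
  \<comment> \<open>The factor g - 1 cannot simply be cancelled in a ring with zero divisors. If the
    sum were nonzero, g - 1 would be even, and then g = 1 by \<open>xi_pow_cong_one\<close>.\<close>
  have "?G q = \<zero>"
  proof (rule ccontr)
    assume "?G q \<noteq> \<zero>"
    then obtain z where z: "z \<in> carrier R" "g \<ominus> \<one> = tw \<otimes> z"
      using zero_divisor_imp_even[of "g \<ominus> \<one>" "?G q"] eq g G[of q] by blast
    have "g = \<one> \<oplus> (g \<ominus> \<one>)" using g by algebra
    then have "\<xi> [^] e = \<one>" using xi_pow_cong_one[of e z] z g_def by simp
    then show False using assms xi_pow_eq_one_iff[of e] by simp
  qed
  then show ?thesis by (simp add: g_def)
qed

text \<open>
  Summing \<open>x\<^sup>-\<^sup>1 tr x\<close> over the nonzero Teichmueller elements kills every power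
  \<open>x ^ (2 ^ j - 1)\<close> with \<open>0 < j < n\<close>, so only the term \<open>j = 0\<close> survives.
\<close>

lemma trace_power_sum:
  "(\<Oplus> k \<in> {..<q}. (\<xi> [^] k) [^] (q - 1) \<otimes> tr (\<xi> [^] k)) = [q] \<cdot> \<one>"
proof -
  let ?S = "\<lambda>m y. \<Oplus> j \<in> {..<m}. (\<phi> ^^ j) y"
  \<comment> \<open>The weight is x^-1 for x = \<xi>^k, written as x^(q-1).\<close>
  let ?w = "\<lambda>k :: nat. (\<xi> [^] k) [^] (q - 1)"
  have pow: "(\<phi> ^^ m) (\<xi> [^] k) = (\<xi> [^] k) [^] (2 ^ m :: nat)" for m and k :: nat
    using frobenius_funpow_digits[of "\<xi> [^] k" \<zero> m] by (auto simp: T_iff nat_pow_zero)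
  have summand: "?w k \<otimes> (\<phi> ^^ m) (\<xi> [^] k) = (\<xi> [^] (q - 1 + 2 ^ m)) [^] k" for m k
  proof -
    have "?w k \<otimes> (\<phi> ^^ m) (\<xi> [^] k) = \<xi> [^] (k * (q - 1 + 2 ^ m))"
      unfolding pow by (simp only: nat_pow_mult nat_pow_pow nat_pow_closed xi_closed distrib_left)
    then show ?thesis by (simp only: nat_pow_pow xi_closed mult.commute)
  qed
  \<comment> \<open>Induction on the number of summands of the trace splits the double sum one
    Frobenius power at a time. The first power, with 2^0 = 1, contributes \<open>q\<close> terms
    equal to 1.\<close>
  have "m \<le> n \<Longrightarrow> m \<ge> 1 \<Longrightarrow> (\<Oplus> k \<in> {..<q}. ?w k \<otimes> ?S m (\<xi> [^] k)) = [q] \<cdot> \<one>" for m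
  proof (induction m)
    case (Suc m)
    have "(\<Oplus> k \<in> {..<q}. ?w k \<otimes> ?S (Suc m) (\<xi> [^] k)) =
          (\<Oplus> k \<in> {..<q}. (\<xi> [^] (q - 1 + 2 ^ m)) [^] k \<oplus> ?w k \<otimes> ?S m (\<xi> [^] k))"
    proof (rule finsum_cong')
      fix k assume "k \<in> {..<q}"
      show "?w k \<otimes> ?S (Suc m) (\<xi> [^] k) = (\<xi> [^] (q - 1 + 2 ^ m)) [^] k \<oplus> ?w k \<otimes> ?S m (\<xi> [^] k)"
        unfolding summand[symmetric] trace_partial_Suc[OF nat_pow_closed[OF xi_closed]]
        by (intro r_distr trace_partial_closed frobenius_funpow_closed nat_pow_closed xi_closed)
    qed (auto simp: trace_partial_closed)
    also have "\<dots> = (\<Oplus> k \<in> {..<q}. (\<xi> [^] (q - 1 + 2 ^ m)) [^] k) \<oplus> (\<Oplus> k \<in> {..<q}. ?w k \<otimes> ?S m (\<xi> [^] k))"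
      using trace_partial_closed by (intro finsum_addf) auto
    also have "\<dots> = [q] \<cdot> \<one>"
    proof (cases "m = 0")
      case True
      have "(\<xi> [^] (q - 1 + 2 ^ m)) [^] k = \<one>" for k :: nat
      proof -
        have "q - 1 + 2 ^ m = q" using True q_pos by simp
        then show ?thesis by (simp only: iffD2[OF xi_pow_eq_one_iff] dvd_refl nat_pow_one)
      qed
      then show ?thesis using True by (simp add: add.finprod_const)
    next
      case False
      \<comment> \<open>The exponent is q + (2^m - 1), and 0 < 2^m - 1 < q because 0 < m <
        n.\<close>
      have "\<not> q dvd q - 1 + 2 ^ m"
      proof
        assume "q dvd q - 1 + 2 ^ m"
        moreover have "q - 1 + 2 ^ m = q + (2 ^ m - 1)" using q_pos by simp
        ultimately have "q dvd 2 ^ m - 1" by (simp only: dvd_add_right_iff dvd_refl)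
        moreover have "(2 :: nat) ^ m < 2 ^ n" using Suc.prems by (intro power_strict_increasing) auto
        moreover have "(2 :: nat) ^ m > 1" using False by (intro one_less_power) auto
        ultimately show False using dvd_imp_le[of q "2 ^ m - 1"] by linarith
      qed
      then show ?thesis unfolding geometric_sum_xi[OF \<open>\<not> q dvd q - 1 + 2 ^ m\<close>] using Suc False by simp
    qed
    finally show ?case .
  qed simp
  then show ?thesis using n_pos by (simp add: trace_def)
qed

text \<open>Digits extend the vanishing from \<open>T\<close> to the whole ring. Since a multiple of
  c equals 2, also 2 tr y = tr (2 y) = 0 for all y. Doubling \<open>trace_power_sum\<close> then
  gives 2 q = 0 in the ring, against \<open>q\<close> being odd.\<close>

lemma trace_nondegenerate:
  assumes c: "c \<in> carrier R" and zero: "\<And>x. x \<in> T \<Longrightarrow> tr4 R n T (c \<otimes> x) = 0"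
  shows "c = \<zero>"
proof (rule ccontr)
  assume "c \<noteq> \<zero>"
  have T0: "tr (c \<otimes> x) = \<zero>" if "x \<in> T" for x
    using zero[OF that] tr4_trace[of "c \<otimes> x"] c T_closed[OF that] by (simp add: zero_multiple)
  have two: "tr (tw \<otimes> y) = tw \<otimes> tr y" if "y \<in> carrier R" for y
    using that trace_add[of y y] by (simp add: two_def l_distr)
  have all: "tr (c \<otimes> y) = \<zero>" if R: "y \<in> carrier R" for y
  proof -
    obtain a b where y: "a \<in> T" "b \<in> T" "y = a \<oplus> tw \<otimes> b" using digits_exist R by blast
    have "c \<otimes> y = c \<otimes> a \<oplus> tw \<otimes> (c \<otimes> b)"
      unfolding y(3) using c y(1,2)[THEN T_closed] two_closed by algebra
    also have "tr \<dots> = tr (c \<otimes> a) \<oplus> tw \<otimes> tr (c \<otimes> b)"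
      using c y(1,2)[THEN T_closed] by (simp add: trace_add two)
    also have "\<dots> = \<zero>" using y by (simp add: T0)
    finally show ?thesis .
  qed
  obtain a b where ab: "a \<in> T" "b \<in> T" "c = a \<oplus> tw \<otimes> b" using digits_exist c by blast
  have inv: "\<exists>v \<in> carrier R. x \<otimes> v = \<one>" if "x \<in> T" "x \<noteq> \<zero>" for x
    using that xi_pow_inverse by (auto simp: T_iff)
  \<comment> \<open>If the first digit is 0, then c = 2 b with b a unit, and the inverse of b
    serves. Otherwise the first digit is a unit, and twice its inverse also annihilates the even
    part of c.\<close>
  obtain e where e: "e \<in> carrier R" "c \<otimes> e = tw"
  proof (cases "a = \<zero>")
    case True
    then have "b \<noteq> \<zero>" using ab \<open>c \<noteq> \<zero>\<close> by auto
    then obtain v where "v \<in> carrier R" "b \<otimes> v = \<one>" using inv ab by blast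
    then show ?thesis using that[of v] ab True T_closed by (simp add: m_assoc)
  next
    case False
    then obtain v where v: "v \<in> carrier R" "a \<otimes> v = \<one>" using inv ab by blast
    have "c \<otimes> (tw \<otimes> v) = tw \<otimes> (a \<otimes> v) \<oplus> tw \<otimes> (tw \<otimes> (b \<otimes> v))"
      unfolding ab(3) using v ab(1,2)[THEN T_closed] two_closed by algebra
    then show ?thesis using that[of "tw \<otimes> v"] v ab T_closed by (simp add: two_mult_two_left)
  qed
  have even: "tw \<otimes> tr y = \<zero>" if "y \<in> carrier R" for y
    using all[of "e \<otimes> y"] e c that by (simp add: two flip: m_assoc)
  have "tw \<otimes> ([q] \<cdot> \<one>) = (\<Oplus> k \<in> {..<q}. tw \<otimes> ((\<xi> [^] k) [^] (q - 1) \<otimes> tr (\<xi> [^] k)))"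
    unfolding trace_power_sum[symmetric] by (intro finsum_rdistr) auto
  also have "\<dots> = (\<Oplus> k \<in> {..<q}. \<zero>)"
    by (intro finsum_cong') (auto simp: m_lcomm[of tw] even)
  also have "\<dots> = \<zero>" by (rule finsum_zero)
  finally have "tw \<otimes> ([q] \<cdot> \<one>) = \<zero>" .
  moreover have "tw \<otimes> ([q] \<cdot> \<one>) = [(2 * int q)] \<cdot> \<one>"
  proof -
    have "tw \<otimes> ([q] \<cdot> \<one>) = [(2 :: int)] \<cdot> ([int q] \<cdot> \<one>)"
      using add_pow_int_ge[of "int q" R \<one>] add_pow_ldistr_int[of \<one> "[q] \<cdot> \<one>" 2]
      by (simp add: two_multiple del: of_nat_diff)
    then show ?thesis by (simp add: add.int_pow_pow mult.commute)
  qed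
  ultimately have "4 dvd 0 - 2 * int q" using int_multiple_eq_iff[of "2 * int q" 0] zero_multiple by simp
  then have "even q" by presburger
  then show False using q_odd by simp
qed

end

section \<open>The module of trace vectors and its phase vectors\<close>

context galois_ring_teichmueller
begin

text \<open>For c with digits a and b this is the exponent vector of
  \<open>mub_vec R n T a b\<close>; indexing by c makes additivity visible.\<close>

definition trace_form :: "'a \<Rightarrow> 'a \<Rightarrow> int" where
  "trace_form c = (\<lambda>x\<in>T. tr4 R n T (c \<otimes> x))"

lemma trace_form_range: "c \<in> carrier R \<Longrightarrow> trace_form c \<in> T \<rightarrow>\<^sub>E {0..3}"
  using tr4_range T_closed by (auto simp: trace_form_def)

lemma trace_form_add:
  "c \<in> carrier R \<Longrightarrow> d \<in> carrier R \<Longrightarrow>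
     trace_form (c \<oplus> d) = (\<lambda>x\<in>T. (trace_form c x + trace_form d x) mod 4)"
  using T_closed by (auto simp: trace_form_def fun_eq_iff l_distr tr4_add)

lemma trace_form_zero: "trace_form \<zero> = (\<lambda>x\<in>T. 0)"
proof -
  have "tr4 R n T \<zero> = 0"
    using tr4_add[of \<zero> \<zero>] tr4_range[of \<zero>] by simp presburger
  then show ?thesis using T_closed by (auto simp: trace_form_def fun_eq_iff)
qed

text \<open>Scalars of Z4 act as repeated addition in the ring, so closure under scaling follows
  from additivity.\<close>

lemma trace_form_multiple:
  assumes "c \<in> carrier R"
  shows "trace_form ([(k :: nat)] \<cdot> c) = (\<lambda>x\<in>T. (int k * trace_form c x) mod 4)"
proof (induction k)
  case 0
  then show ?case by (simp add: trace_form_zero)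
next
  case (Suc k)
  have "trace_form ([Suc k] \<cdot> c) = (\<lambda>x\<in>T. (trace_form ([k] \<cdot> c) x + trace_form c x) mod 4)"
    using assms trace_form_add[of "[k] \<cdot> c" c] by simp
  also have "\<dots> = (\<lambda>x\<in>T. (int (Suc k) * trace_form c x) mod 4)"
    unfolding Suc by (auto simp: fun_eq_iff mod_simps algebra_simps)
  finally show ?case .
qed

lemma trace_form_eq_zero:
  assumes "c \<in> carrier R" "\<And>x. x \<in> T \<Longrightarrow> 4 dvd trace_form c x"
  shows "c = \<zero>"
proof (rule trace_nondegenerate[OF assms(1)])
  fix x assume x: "x \<in> T"
  have "tr4 R n T (c \<otimes> x) \<in> {0..3}" using tr4_range assms(1) x T_closed by auto
  moreover have "4 dvd tr4 R n T (c \<otimes> x)" using assms(2)[OF x] x by (simp add: trace_form_def)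
  moreover have "k = 0" if "k \<in> {0..3}" "4 dvd k" for k :: int
    using that unfolding atLeastAtMost_iff by presburger
  ultimately show "tr4 R n T (c \<otimes> x) = 0" by blast
qed

lemma trace_form_inj: "inj_on trace_form (carrier R)"
proof (rule inj_onI)
  fix c d assume c: "c \<in> carrier R" and d: "d \<in> carrier R" and eq: "trace_form c = trace_form d"
  have "c = (c \<ominus> d) \<oplus> d" using c d by algebra
  then have sum: "trace_form c = (\<lambda>x\<in>T. (trace_form (c \<ominus> d) x + trace_form d x) mod 4)"
    using trace_form_add[of "c \<ominus> d" d] c d by simp
  have "4 dvd trace_form (c \<ominus> d) x" if "x \<in> T" for x
  proof -
    have "trace_form d x = (trace_form (c \<ominus> d) x + trace_form d x) mod 4"
      using fun_cong[OF sum, of x] eq that by simp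
    moreover have "4 dvd u" if "v = (u + v) mod 4" for u v :: int using that by presburger
    ultimately show ?thesis by blast
  qed
  then have "c \<ominus> d = \<zero>" using trace_form_eq_zero[of "c \<ominus> d"] c d by blast
  then show "c = d" using c d by simp
qed

text \<open>An even vector is killed by 2, so 2 c = 0 by nondegeneracy. Then c = 2 d in the ring,
  and the vector of d is the required half.\<close>

lemma trace_form_even:
  assumes c: "c \<in> carrier R" and even: "\<forall>x\<in>T. 2 dvd trace_form c x"
  shows "\<exists>w\<in>trace_form ` carrier R. \<forall>x\<in>T. 4 dvd trace_form c x - 2 * w x"
proof -
  have double: "[(2 :: nat)] \<cdot> y = tw \<otimes> y" if "y \<in> carrier R" for y
    using that by (simp add: numeral_2_eq_2 two_def l_distr)
  have "4 dvd trace_form (tw \<otimes> c) x" if "x \<in> T" for x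
  proof -
    have "trace_form (tw \<otimes> c) x = (2 * trace_form c x) mod 4"
      using trace_form_multiple[OF c, of 2] that c by (simp add: double)
    moreover have "4 dvd (2 * k) mod 4" if "2 dvd k" for k :: int using that by presburger
    ultimately show ?thesis using even that by simp
  qed
  then have "tw \<otimes> c = \<zero>" using trace_form_eq_zero[of "tw \<otimes> c"] c by blast
  then obtain d where d: "d \<in> carrier R" "c = tw \<otimes> d" using two_annihilator[OF c] by blast
  have "trace_form c = (\<lambda>x\<in>T. (2 * trace_form d x) mod 4)"
    using trace_form_multiple[OF d(1), of 2] d by (simp add: double)
  moreover have "4 dvd (2 * k) mod 4 - 2 * k" for k :: int by presburger
  ultimately show ?thesis using d(1) by (intro bexI[of _ "trace_form d"]) auto
qed

lemma trace_form_submodule: "submodule (trace_form ` carrier R) Z4 (Z4_power T)"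
proof (rule submodule_Z4_powerI)
  show "trace_form ` carrier R \<subseteq> T \<rightarrow>\<^sub>E {0..3}" using trace_form_range by blast
  show "(\<lambda>j\<in>T. 0) \<in> trace_form ` carrier R"
    unfolding trace_form_zero[symmetric] by simp
next
  fix x y assume "x \<in> trace_form ` carrier R" "y \<in> trace_form ` carrier R"
  then show "(\<lambda>j\<in>T. (x j + y j) mod 4) \<in> trace_form ` carrier R"
    by (elim imageE) (simp only: trace_form_add[symmetric] imageI a_closed)
next
  fix r x assume r: "r \<in> {0..3 :: int}" and "x \<in> trace_form ` carrier R"
  then obtain c where c: "c \<in> carrier R" "x = trace_form c" by blast
  have "(\<lambda>j\<in>T. (r * x j) mod 4) = trace_form ([nat r] \<cdot> c)"
    unfolding c(2) using trace_form_multiple[OF c(1), of "nat r"] r by simp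
  then show "(\<lambda>j\<in>T. (r * x j) mod 4) \<in> trace_form ` carrier R" using c(1) by simp
qed

lemma T_nonempty: "T \<noteq> {}"
  using zero_in_T by blast

text \<open>As n \<ge> 1 there are at least two coordinates, so a standard basis vector has a zero
  entry, while a phase vector has none. Restricting to phase vectors thus discards the whole
  standard basis.\<close>

lemma standard_basis_not_phase_vec:
  assumes "v \<in> standard_basis T"
  shows "v \<noteq> phase_vec T x"
proof
  assume eq: "v = phase_vec T x"
  obtain k where v: "v = (\<lambda>j\<in>T. if j = k then 1 else 0)" using assms by (auto simp: standard_basis_def)
  have "card T > 1" unfolding card_T using n_pos by (intro one_less_power) auto
  then obtain j where j: "j \<in> T" "j \<noteq> k"
    by (metis is_singletonI' is_singleton_altdef less_irrefl T_nonempty)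
  then have "phase_vec T x j = 0" unfolding eq[symmetric] v by simp
  moreover have "phase_vec T x j \<noteq> 0" using j \<open>card T > 1\<close> by (simp add: phase_vec_def)
  ultimately show False by simp
qed

lemma mub_vecs_eq: "{mub_vec R n T a b | a b. a \<in> T \<and> b \<in> T} = phase_vec T ` trace_form ` carrier R"
proof -
  have "\<exists>a b. y = from_digits R a b \<and> a \<in> T \<and> b \<in> T" if y: "y \<in> carrier R" for y
    using digits_exist[OF y] unfolding from_digits_def by blast
  moreover have "from_digits R a b \<in> carrier R" if "a \<in> T" "b \<in> T" for a b
    using that T_closed by (simp add: from_digits_def)
  ultimately have carrier: "carrier R = {from_digits R a b | a b. a \<in> T \<and> b \<in> T}" by blast
  have mub: "mub_vec R n T a b = phase_vec T (trace_form (from_digits R a b))" for a b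
    by (simp add: mub_vec_def trace_form_def)
  show ?thesis unfolding mub image_image carrier by blast
qed

lemma phase_vecs_of_galois_mubs:
  "{v \<in> \<Union> (galois_mubs R n T). \<exists>x \<in> T \<rightarrow>\<^sub>E carrier Z4. v = phase_vec T x} =
     phase_vec T ` trace_form ` carrier R"
proof -
  have "\<Union> (galois_mubs R n T) = standard_basis T \<union> phase_vec T ` trace_form ` carrier R"
    unfolding mub_vecs_eq[symmetric] galois_mubs_def by blast
  then show ?thesis
    using standard_basis_not_phase_vec trace_form_range unfolding carrier_Z4 by blast
qed

lemma phase_exponents_of_galois_mubs:
  "{x \<in> T \<rightarrow>\<^sub>E carrier Z4. phase_vec T x \<in> phase_vec T ` trace_form ` carrier R} = trace_form ` carrier R"
  (is "?M = ?F")
proof (rule Set.set_eqI)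
  fix x
  have F: "?F \<subseteq> T \<rightarrow>\<^sub>E {0..3}" using trace_form_range by blast
  show "x \<in> ?M \<longleftrightarrow> x \<in> ?F"
    using inj_on_image_mem_iff[OF phase_vec_inj_on[OF finite_T T_nonempty] _ F, of x] F
    unfolding carrier_Z4 by blast
qed

lemma trace_form_phg_subspace: "phg_subspace T (n - 1) (trace_form ` carrier R)"
proof -
  have "\<exists>B. free_basis Z4 (Z4_power T) (trace_form ` carrier R) B \<and> card B = n"
  proof (rule free_basis_exists[OF trace_form_submodule])
    show "card (trace_form ` carrier R) = 4 ^ n"
      using trace_form_inj by (simp add: card_image card_carrier)
    show "finite (trace_form ` carrier R)" using finite_carrier by simp
    fix x assume "x \<in> trace_form ` carrier R" "\<forall>j\<in>T. 2 dvd x j"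
    then show "\<exists>w\<in>trace_form ` carrier R. \<forall>j\<in>T. 4 dvd x j - 2 * w j"
      using trace_form_even by blast
  qed
  then show ?thesis
    unfolding phg_subspace_def using trace_form_submodule n_pos by simp
qed

end

text \<open>The projective dimension is \<open>n - 1\<close>: \<open>M\<close> has 4^n elements and
  is free of rank n. The number 2^(n-1) of the prose statement is the number of points in each
  neighbourhood; as a dimension it would require rank 2^(n-1) + 1, which exceeds n.\<close>

theorem theorem14:
  fixes R :: "('a, 'b) ring_scheme" and n :: nat and \<xi> :: 'a and T :: "'a set"
    and X N :: "('a \<Rightarrow> complex) set" and M :: "('a \<Rightarrow> int) set"
  assumes "n \<ge> 1"
    and "galois_ring4 n R"
    and "\<xi> \<in> Units R" and "group.ord (units_of R) \<xi> = 2 ^ n - 1"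
    and "T = teichmueller R n \<xi>"
    and "X = \<Union> (galois_mubs R n T)"
    and "N = {v \<in> X. \<exists>x \<in> T \<rightarrow>\<^sub>E carrier Z4. v = phase_vec T x}"
    and "M = {x \<in> T \<rightarrow>\<^sub>E carrier Z4. phase_vec T x \<in> N}"
  shows "Module.module Z4 (phase_module T N) \<and> phg_subspace T (n - 1) M"
proof -
  interpret galois_ring_teichmueller R n \<xi> T
    using assms(1-5) by (auto intro!: galois_ring_teichmueller.intro
        galois_ring_teichmueller_axioms.intro simp: galois_ring4_def)
  have N: "N = phase_vec T ` trace_form ` carrier R"
    unfolding assms(6,7) by (rule phase_vecs_of_galois_mubs)
  have M: "M = trace_form ` carrier R"
    unfolding assms(8) N by (rule phase_exponents_of_galois_mubs)
  show ?thesis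
    unfolding N M
    using module_phase_module[OF finite_T T_nonempty trace_form_submodule] trace_form_phg_subspace
    by blast
qed

end
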